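(* Let $k\in\mathbb{N}_0$ and $s\in(0,1)$ be arbitrary. Then for every $f\in C^k([0,1])$ and every $\varepsilon>0$ there exist an initial point $a<0$ and a function $u\in C_a^{1,s}$ such that $$D_a^s u(x)=0\quad\text{for all } x\in[0,\infty)$$ and $$\|u-f\|_{C^k([0,1])}<\varepsilon .$$
   Context: $\mathbb{N}_0=\{0,1,2,\dots\}$. For $k\in\mathbb{N}_0$, $C^k([0,1])$ is the space of $k$-times continuously differentiable real functions on $[0,1]$ with norm $\|f\|_{C^k([0,1])}=\sum_{i=0}^k\sup_{x\in[0,1]}|f^{(i)}(x)|$. For $a\in\mathbb{R}$ and $s\in(0,1)$, $C_a^{1,s}$ is the set of functions $f:\mathbb{R}\to\mathbb{R}$ such that for every $x>a$, $f$ is absolutely continuous on $[a,x]$ and the function $t\mapsto f'(t)(x-t)^{-s}$ belongs to $L^1((a,x))$. The Caputo derivative of $u\in C_a^{1,s}$ with initial point $a$ at a point $x>a$ is $$D_a^s u(x):=\frac{1}{\Gamma(1-s)}\int_a^x u'(t)(x-t)^{-s}\,dt,$$ where $\Gamma$ is the Gamma function. By convention, a function whose Caputo derivative $D_a^s$ is taken is assumed to be constant, equal to $u(a)$, on $(-\infty,a)$. *)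

theory Defs
  imports "HOL-Analysis.Analysis"
begin

(* Derivatives are taken relative to S; for S = {0..1} they are one-sided at the endpoints. *)
definition nth_deriv_on :: "real set \<Rightarrow> nat \<Rightarrow> (real \<Rightarrow> real) \<Rightarrow> real \<Rightarrow> real" where
  "nth_deriv_on S n f = ((\<lambda>g x. vector_derivative g (at x within S)) ^^ n) f"

(* Elements of C^k(S) are represented by total functions; only their values on S matter. *)
definition Ck_on :: "nat \<Rightarrow> real set \<Rightarrow> (real \<Rightarrow> real) set" where
  "Ck_on k S = {f. (\<forall>i<k. nth_deriv_on S i f differentiable_on S) \<and>
                   (\<forall>i\<le>k. continuous_on S (nth_deriv_on S i f))}"

(* A supremum of reals, hence only meaningful on Ck_on k S with S compact and nonempty. *)
definition Ck_norm :: "nat \<Rightarrow> real set \<Rightarrow> (real \<Rightarrow> real) \<Rightarrow> real" where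
  "Ck_norm k S f = (\<Sum>i\<le>k. SUP x\<in>S. \<bar>nth_deriv_on S i f x\<bar>)"

(* Absolute continuity of a function; the library's absolutely_continuous concerns measures. *)
definition abs_continuous_on_interval :: "real \<Rightarrow> real \<Rightarrow> (real \<Rightarrow> real) \<Rightarrow> bool" where
  "abs_continuous_on_interval a b f \<longleftrightarrow>
     (\<forall>\<epsilon>>0. \<exists>\<delta>>0. \<forall>(n::nat) (l::nat \<Rightarrow> real) (r::nat \<Rightarrow> real).
        (\<forall>i<n. a \<le> l i \<and> l i \<le> r i \<and> r i \<le> b) \<longrightarrow>
        disjoint_family_on (\<lambda>i. {l i<..<r i}) {..<n} \<longrightarrow>
        (\<Sum>i<n. r i - l i) < \<delta> \<longrightarrow>
        (\<Sum>i<n. \<bar>f (r i) - f (l i)\<bar>) < \<epsilon>)"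

(* An absolutely continuous f is differentiable almost everywhere; deriv f is unspecified on the
   exceptional null set, which affects neither integrability nor the integral over lebesgue. *)
definition C1s :: "real \<Rightarrow> real \<Rightarrow> (real \<Rightarrow> real) set" where
  "C1s a s = {f. \<forall>x>a. abs_continuous_on_interval a x f \<and>
                 set_integrable lebesgue {a<..<x} (\<lambda>t. deriv f t * (x - t) powr (- s))}"

definition caputo_deriv :: "real \<Rightarrow> real \<Rightarrow> (real \<Rightarrow> real) \<Rightarrow> real \<Rightarrow> real" where
  "caputo_deriv a s u x =
     1 / Gamma (1 - s) * (LINT t:{a<..<x}|lebesgue. deriv u t * (x - t) powr (- s))"

end

theory Submission
  imports Defs "HOL-Complex_Analysis.Complex_Analysis"
begin

text \<open>
  Prescribe \<open>u'\<close> on the negative half-line by a continuous weight \<open>w\<close> with compact support in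
  \<open>{b. b \<ge> 1}\<close>. Requiring the Caputo derivative to vanish on \<open>(0, \<infinity>)\<close> is Abel's integral
  equation, whose explicit solution is \<open>u'(t) = t powr (s - 1) * H(t)\<close> with the Stieltjes transform
  \<open>H(t) = \<integral> w(b) / (t + b) db\<close>. Translating by \<open>2\<close> moves the singularity at \<open>0\<close> away from
  \<open>[0, 1]\<close>, so it remains to see that \<open>t powr (s - 1) * H(t)\<close> can approximate any polynomial together
  with its derivatives on \<open>[2, 3]\<close>. The uniform closure of the Stieltjes transforms on a disc in the
  right half-plane contains the constants, because \<open>c / (z + c) \<rightarrow> 1\<close> as \<open>c \<rightarrow> \<infinity>\<close>, and it
  is closed under multiplication by \<open>z\<close>, because \<open>z / (z + b) = 1 - b / (z + b)\<close>. Hence it contains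
  all functions holomorphic near the disc, and Cauchy's inequality passes from uniform closeness
  to closeness of all derivatives.
\<close>

section \<open>Density of Stieltjes transforms\<close>

text \<open>The gap between 0 and the support keeps \<open>1 / (z + b)\<close> regular up to the
  imaginary axis and makes the prescribed derivative vanish near 0. Boundedness of the support
  allows a finite initial point.\<close>

definition weight :: "(real \<Rightarrow> complex) \<Rightarrow> bool" where
  "weight w \<longleftrightarrow> continuous_on UNIV w \<and> (\<exists>d\<ge>1. \<forall>b. b \<notin> {1..d} \<longrightarrow> w b = 0)"

text \<open>Integrating over the whole line makes linearity in the weight independent of any
  particular bound \<open>d\<close>; \<open>stieltjes_integral_eq\<close> recovers the compact
  interval.\<close>

definition stieltjes :: "(real \<Rightarrow> complex) \<Rightarrow> complex \<Rightarrow> complex" where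
  "stieltjes w z = integral UNIV (\<lambda>b. w b / (z + of_real b))"

lemma weight_obtain_common:
  assumes "weight v" "weight w"
  obtains d where "d \<ge> 1" "\<And>b. b \<notin> {1..d} \<Longrightarrow> v b = 0" "\<And>b. b \<notin> {1..d} \<Longrightarrow> w b = 0"
proof -
  obtain d1 d2 where "d1 \<ge> 1" "\<And>b. b \<notin> {1..d1} \<Longrightarrow> v b = 0" "\<And>b. b \<notin> {1..d2} \<Longrightarrow> w b = 0"
    using assms unfolding weight_def by metis
  then show thesis
    using that[of "max d1 d2"] by (auto simp: le_max_iff_disj)
qed

lemma weight_add:
  assumes "weight v" "weight w"
  shows "weight (\<lambda>b. v b + w b)"
proof -
  obtain d where "d \<ge> 1" "\<And>b. b \<notin> {1..d} \<Longrightarrow> v b = 0" "\<And>b. b \<notin> {1..d} \<Longrightarrow> w b = 0"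
    using weight_obtain_common[OF assms] by blast
  then show ?thesis
    using assms unfolding weight_def by (intro conjI continuous_on_add exI[of _ d]) auto
qed

lemma weight_mult:
  assumes "weight w" "continuous_on UNIV g"
  shows "weight (\<lambda>b. g b * w b)"
  using assms unfolding weight_def by (force intro!: continuous_intros)

lemma stieltjes_integral_eq:
  assumes "\<And>b. b \<notin> {1..d} \<Longrightarrow> w b = 0"
  shows "stieltjes w z = integral {1..d} (\<lambda>b. w b / (z + of_real b))"
proof -
  have "(\<lambda>b. w b / (z + of_real b)) = (\<lambda>b. if b \<in> {1..d} then w b / (z + of_real b) else 0)"
    using assms by fastforce
  then show ?thesis
    unfolding stieltjes_def by (metis integral_restrict_UNIV)
qed

lemma weight_supported_integrable:
  fixes g :: "real \<Rightarrow> complex"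
  assumes "\<And>b. b \<notin> {1..d} \<Longrightarrow> g b = 0" "continuous_on {1..d} g"
  shows "g integrable_on UNIV"
  using integrable_on_superset[of g "{1..d}" UNIV] assms integrable_continuous_real by blast

lemma add_of_real_nonzero: "Re z > 0 \<Longrightarrow> b \<ge> 0 \<Longrightarrow> z + of_real b \<noteq> 0"
  by (metis add_pos_nonneg Re_complex_of_real less_irrefl plus_complex.sel(1) zero_complex.sel(1))

lemma weight_continuous: "weight w \<Longrightarrow> continuous_on A w"
  unfolding weight_def using continuous_on_subset by blast

lemma stieltjes_integrable:
  assumes "weight w" "Re z > 0"
  shows "(\<lambda>b. w b / (z + of_real b)) integrable_on UNIV"
proof -
  obtain d where d: "\<And>b. b \<notin> {1..d} \<Longrightarrow> w b = 0"
    using assms unfolding weight_def by auto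
  show ?thesis
  proof (rule weight_supported_integrable)
    show "w b / (z + complex_of_real b) = 0" if "b \<notin> {1..d}" for b
      using d[OF that] by simp
    have "z + of_real b \<noteq> 0" if "b \<in> {1..d}" for b
      using assms that by (intro add_of_real_nonzero) auto
    then show "continuous_on {1..d} (\<lambda>b. w b / (z + complex_of_real b))"
      using assms(1) by (intro continuous_intros weight_continuous) auto
  qed
qed

lemma weight_integrable: "weight w \<Longrightarrow> w integrable_on UNIV"
  unfolding weight_def using weight_supported_integrable continuous_on_subset
  by (metis subset_UNIV)

lemma stieltjes_add:
  assumes "weight v" "weight w" "Re z > 0"
  shows "stieltjes (\<lambda>b. v b + w b) z = stieltjes v z + stieltjes w z"
  using assms unfolding stieltjes_def
  by (simp add: add_divide_distrib Henstock_Kurzweil_Integration.integral_add stieltjes_integrable)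

lemma stieltjes_cmult: "stieltjes (\<lambda>b. c * w b) z = c * stieltjes w z"
  unfolding stieltjes_def by (simp flip: times_divide_eq_right)

text \<open>Integrate \<open>z / (z + b) = 1 - b / (z + b)\<close> against \<open>w\<close>:
  multiplication by \<open>z\<close> changes the weight and costs only a constant, the total
  mass.\<close>

lemma stieltjes_times:
  assumes "weight w" "Re z > 0"
  shows "z * stieltjes w z = integral UNIV w + stieltjes (\<lambda>b. - of_real b * w b) z"
proof -
  have "stieltjes (\<lambda>b. - of_real b * w b) z = integral UNIV (\<lambda>b. z * (w b / (z + of_real b)) - w b)"
    unfolding stieltjes_def
  proof (rule integral_cong)
    fix b :: real
    show "- of_real b * w b / (z + of_real b) = z * (w b / (z + of_real b)) - w b"
    \<comment> \<open>A zero denominator forces \<open>b < 0\<close>, hence \<open>w b = 0\<close>,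
      and both sides are 0.\<close>
    proof (cases "z + of_real b = 0")
      case True
      then have "b < 0" using assms(2) add_of_real_nonzero not_le by blast
      then have "w b = 0" using assms(1) unfolding weight_def by fastforce
      then show ?thesis by simp
    qed (simp add: divide_simps algebra_simps)
  qed
  also have "\<dots> = z * stieltjes w z - integral UNIV w"
    using stieltjes_integrable[OF assms] weight_integrable[OF assms(1)] unfolding stieltjes_def
    by (subst Henstock_Kurzweil_Integration.integral_diff)
       (simp_all only: integral_mult_right integrable_on_mult_right)
  finally show ?thesis by simp
qed

text \<open>The \<open>z\<close>-derivative of the integrand is jointly continuous on the half-plane
  times the compact support, so one may differentiate under the integral sign.\<close>

lemma stieltjes_holomorphic:
  assumes "weight w"
  shows "stieltjes w holomorphic_on {z. Re z > 0}"
proof -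
  obtain d where d: "\<And>b. b \<notin> {1..d} \<Longrightarrow> w b = 0"
    using assms unfolding weight_def by auto
  have nz: "z + of_real b \<noteq> 0" if "0 < Re z" "b \<in> {1..d}" for z b
    using that by (intro add_of_real_nonzero) auto
  have "(\<lambda>z. integral (cbox 1 d) (\<lambda>b. w b / (z + of_real b))) holomorphic_on {z. Re z > 0}"
  proof (rule leibniz_rule_holomorphic)
    fix z b assume z: "z \<in> {z. 0 < Re z}" and b: "b \<in> cbox 1 d"
    show "((\<lambda>z. w b / (z + of_real b)) has_field_derivative - w b / (z + of_real b)^2) (at z within {z. 0 < Re z})"
      using nz[of z b] z b by (auto intro!: derivative_eq_intros simp: power2_eq_square)
  next
    fix z assume z: "z \<in> {z. 0 < Re z}"
    show "(\<lambda>b. w b / (z + of_real b)) integrable_on cbox 1 d"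
      using stieltjes_integrable[OF assms, of z] z integrable_on_subcbox by blast
  next
    have "continuous_on A (\<lambda>x. w (snd x))" for A :: "(complex \<times> real) set"
      using weight_continuous[OF assms, of UNIV]
      by (rule continuous_on_compose2) (auto intro!: continuous_intros)
    then show "continuous_on ({z. 0 < Re z} \<times> cbox 1 d) (\<lambda>(z, b). - w b / (z + of_real b)^2)"
      using nz by (auto simp: split_beta intro!: continuous_intros)
  qed (rule convex_halfspace_Re_gt)
  then show ?thesis
    using stieltjes_integral_eq[of d w] d by (auto simp: cbox_interval cong: holomorphic_cong)
qed

section \<open>The uniform closure of the Stieltjes transforms on a set\<close>

definition stieltjes_approximable :: "complex set \<Rightarrow> (complex \<Rightarrow> complex) \<Rightarrow> bool" where
  "stieltjes_approximable D g \<longleftrightarrow> (\<forall>e>0. \<exists>w. weight w \<and> (\<forall>z\<in>D. norm (stieltjes w z - g z) < e))"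

lemma stieltjes_approximable_add:
  assumes "stieltjes_approximable D f" "stieltjes_approximable D g" "\<And>z. z \<in> D \<Longrightarrow> Re z > 0"
  shows "stieltjes_approximable D (\<lambda>z. f z + g z)"
  unfolding stieltjes_approximable_def
proof (intro allI impI)
  fix e :: real assume "e > 0"
  then have e: "e/2 > 0" by simp
  obtain v w where v: "weight v" "\<forall>z\<in>D. norm (stieltjes v z - f z) < e/2"
    and w: "weight w" "\<forall>z\<in>D. norm (stieltjes w z - g z) < e/2"
    using assms(1,2) e unfolding stieltjes_approximable_def by metis
  have "norm (stieltjes (\<lambda>b. v b + w b) z - (f z + g z)) < e" if "z \<in> D" for z
  proof -
    have "stieltjes (\<lambda>b. v b + w b) z - (f z + g z) = (stieltjes v z - f z) + (stieltjes w z - g z)"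
      using stieltjes_add[OF v(1) w(1)] assms(3)[OF that] by simp
    then show ?thesis
      using norm_triangle_ineq[of "stieltjes v z - f z" "stieltjes w z - g z"] v(2) w(2) that
      by (smt (verit) field_sum_of_halves)
  qed
  then show "\<exists>w. weight w \<and> (\<forall>z\<in>D. norm (stieltjes w z - (f z + g z)) < e)"
    using weight_add[OF v(1) w(1)] by blast
qed

lemma stieltjes_approximable_cmult:
  assumes "stieltjes_approximable D f"
  shows "stieltjes_approximable D (\<lambda>z. c * f z)"
  unfolding stieltjes_approximable_def
proof (intro allI impI)
  fix e :: real assume "e > 0"
  \<comment> \<open>The summand 1 covers \<open>c = 0\<close> and makes the final inequality
    strict.\<close>
  then have e: "e/(norm c + 1) > 0" by (simp add: add_nonneg_pos)
  obtain w where w: "weight w" "\<And>z. z\<in>D \<Longrightarrow> norm (stieltjes w z - f z) < e/(norm c + 1)"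
    using assms e unfolding stieltjes_approximable_def by metis
  have "norm (stieltjes (\<lambda>b. c * w b) z - c * f z) < e" if "z \<in> D" for z
  proof -
    have "norm (stieltjes (\<lambda>b. c * w b) z - c * f z) = norm c * norm (stieltjes w z - f z)"
      by (simp add: stieltjes_cmult norm_mult flip: right_diff_distrib)
    also have "\<dots> \<le> norm c * (e/(norm c + 1))"
      using w(2)[OF that] by (intro mult_left_mono) auto
    also have "\<dots> < e" using \<open>e > 0\<close> by (simp add: divide_simps add_nonneg_pos)
    finally show ?thesis .
  qed
  then show "\<exists>w. weight w \<and> (\<forall>z\<in>D. norm (stieltjes w z - c * f z) < e)"
    using weight_mult[OF w(1), of "\<lambda>_. c"] by auto
qed

text \<open>A continuous substitute for the unit point mass at \<open>c\<close>, whose transform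
  would be \<open>1 / (z + c)\<close>. Its support is \<open>[c - 1, c + 1]\<close>, whence
  \<open>c \<ge> 2\<close> in \<open>weight_hat\<close>.\<close>

definition hat :: "real \<Rightarrow> real \<Rightarrow> real" where
  "hat c b = max 0 (1 - \<bar>b - c\<bar>)"

lemma weight_hat: "c \<ge> 2 \<Longrightarrow> weight (\<lambda>b. of_real (hat c b))"
  unfolding weight_def hat_def by (auto intro!: continuous_intros exI[of _ "c + 1"])

lemma has_integral_hat: "((\<lambda>b. complex_of_real (hat c b)) has_integral 1) UNIV"
proof -
  have 1: "((\<lambda>b. 1 + (b - c)) has_integral ((c - c) + (c - c)^2/2 - ((c-1-c) + (c-1-c)^2/2))) {c-1..c}"
    by (rule fundamental_theorem_of_calculus)
       (auto intro!: derivative_eq_intros simp flip: has_real_derivative_iff_has_vector_derivative)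
  have 2: "((\<lambda>b. 1 - (b - c)) has_integral ((c+1 - c) - (c+1 - c)^2/2 - ((c-c) - (c-c)^2/2))) {c..c+1}"
    by (rule fundamental_theorem_of_calculus)
       (auto intro!: derivative_eq_intros simp: field_simps simp flip: has_real_derivative_iff_has_vector_derivative)
  have 1: "(hat c has_integral 1/2) {c-1..c}"
    using 1 by (rule has_integral_eq_rhs[OF has_integral_eq, rotated]) (auto simp: hat_def)
  have 2: "(hat c has_integral 1/2) {c..c+1}"
    using 2 by (rule has_integral_eq_rhs[OF has_integral_eq, rotated]) (auto simp: hat_def)
  have "(hat c has_integral (1/2 + 1/2)) {c-1..c+1}"
    by (rule has_integral_combine[OF _ _ 1 2]) auto
  moreover have zero: "hat c b = 0" if "b \<notin> {c-1..c+1}" for b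
    using that by (auto simp: hat_def)
  ultimately have "(hat c has_integral 1) UNIV"
    using zero has_integral_on_superset[of "hat c" 1 "{c-1..c+1}" UNIV] by simp
  from has_integral_linear[OF this bounded_linear_of_real] show ?thesis
    by (simp add: o_def)
qed

text \<open>A hat at distance \<open>c\<close> scaled by \<open>c\<close> has transform close to \<open>1\<close>, as \<open>c / (z + c) \<rightarrow> 1\<close>.\<close>

lemma stieltjes_approximable_one:
  assumes "\<And>z. z \<in> D \<Longrightarrow> Re z > 0" "bounded D"
  shows "stieltjes_approximable D (\<lambda>_. 1)"
  unfolding stieltjes_approximable_def
proof (intro allI impI)
  fix e :: real assume "e > 0"
  obtain R where R: "\<And>z. z \<in> D \<Longrightarrow> norm z \<le> R" using assms(2) unfolding bounded_iff by blast
  \<comment> \<open>The value 2 keeps the support of the hat to the right of 1; the other term makes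
    the final bound \<open>(\<bar>R\<bar> + 1) / (c - 1)\<close> strictly smaller than
    \<open>e\<close>.\<close>
  define c where "c = max 2 (1 + (\<bar>R\<bar> + 2) / e)"
  have c: "c \<ge> 2" "c > 1" "c - 1 \<ge> (\<bar>R\<bar> + 2) / e" unfolding c_def by auto
  define w where "w = (\<lambda>b. of_real c * complex_of_real (hat c b))"
  have w: "weight w"
    unfolding w_def by (rule weight_mult) (use c in \<open>auto intro: weight_hat\<close>)
  have "norm (stieltjes w z - 1) < e" if "z \<in> D" for z
  proof -
    have z: "Re z > 0" "norm z \<le> R" using assms(1) R that by auto
    have int: "(\<lambda>b. (of_real c / (z + of_real b) - 1) * complex_of_real (hat c b)) integrable_on UNIV"
    proof -
      have "(\<lambda>b. w b / (z + of_real b) - complex_of_real (hat c b)) integrable_on UNIV"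
        using has_integral_hat[of c] stieltjes_integrable[OF w z(1)]
        by (intro Henstock_Kurzweil_Integration.integrable_diff) (auto simp: integrable_on_def)
      then show ?thesis
        by (simp add: w_def left_diff_distrib)
    qed
    have "stieltjes w z - 1 = integral UNIV (\<lambda>b. w b / (z + of_real b)) - integral UNIV (\<lambda>b. complex_of_real (hat c b))"
      unfolding stieltjes_def using integral_unique[OF has_integral_hat[of c]] by simp
    also have "\<dots> = integral UNIV (\<lambda>b. w b / (z + of_real b) - complex_of_real (hat c b))"
      using has_integral_hat[of c] stieltjes_integrable[OF w z(1)]
      by (intro Henstock_Kurzweil_Integration.integral_diff[symmetric]) (auto simp: integrable_on_def)
    also have "\<dots> = integral UNIV (\<lambda>b. (of_real c / (z + of_real b) - 1) * complex_of_real (hat c b))"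
      by (simp add: w_def left_diff_distrib)
    \<comment> \<open>The factor equals \<open>(c - b - z) / (z + b)\<close>. On the support of the
      hat its numerator is at most \<open>1 + R\<close> in norm, and its denominator at least
      \<open>c - 1\<close> because \<open>Re z > 0\<close>.\<close>
    also have "norm \<dots> \<le> integral UNIV (\<lambda>b. (\<bar>R\<bar> + 1) / (c - 1) * hat c b)"
    proof (rule integral_norm_bound_integral[OF int])
      have "(hat c) integrable_on UNIV"
        using integrable_linear[OF has_integral_integrable[OF has_integral_hat[of c]] bounded_linear_Re]
        by (simp add: o_def)
      then show "(\<lambda>b. (\<bar>R\<bar> + 1) / (c - 1) * hat c b) integrable_on UNIV"
        by (rule integrable_on_mult_right)
      fix b :: real
      show "norm ((of_real c / (z + of_real b) - 1) * complex_of_real (hat c b)) \<le> (\<bar>R\<bar> + 1) / (c - 1) * hat c b"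
      proof (cases "b \<in> {c-1..c+1}")
        case True
        have ge: "norm (z + of_real b) \<ge> c - 1"
          using complex_Re_le_cmod[of "z + of_real b"] z True by auto
        then have nz: "z + of_real b \<noteq> 0" using c by auto
        have eq: "of_real c / (z + of_real b) - 1 = (of_real (c - b) - z) / (z + of_real b)"
          using nz by (simp add: divide_simps)
        have "norm (of_real (c - b) - z) \<le> 1 + R"
          using norm_triangle_ineq4[of "complex_of_real (c-b)" z] z True
          by (smt (verit) abs_le_iff atLeastAtMost_iff norm_of_real)
        then have "norm (of_real c / (z + of_real b) - 1) \<le> (\<bar>R\<bar> + 1) / (c - 1)"
          unfolding eq norm_divide using ge c by (intro frac_le) auto
        then show ?thesis
          using mult_right_mono[of _ _ "hat c b"] by (simp add: norm_mult hat_def del: times_divide_eq_left)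
      qed (auto simp: hat_def)
    qed
    also have "\<dots> = (\<bar>R\<bar> + 1) / (c - 1)"
      using integral_unique[OF has_integral_linear[OF has_integral_hat[of c] bounded_linear_Re]] by (simp add: o_def)
    also have "\<dots> < e"
    proof -
      have "\<bar>R\<bar> + 2 \<le> (c - 1) * e" using c(3) \<open>e > 0\<close> by (simp add: pos_divide_le_eq)
      then show ?thesis using c(2) by (simp add: pos_divide_less_eq mult.commute)
    qed
    finally show ?thesis .
  qed
  then show "\<exists>w. weight w \<and> (\<forall>z\<in>D. norm (stieltjes w z - 1) < e)"
    using w by blast
qed

text \<open>By \<open>stieltjes_times\<close>, \<open>z\<close> times a transform is a transform
  plus a constant, and constants are approximable. The constant contributes an error
  \<open>e/2\<close>, and the error of \<open>g\<close>, enlarged at most by the bound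
  \<open>R\<close> on \<open>D\<close>, contributes the other half.\<close>

lemma stieltjes_approximable_times:
  assumes "stieltjes_approximable D g" "\<And>z. z \<in> D \<Longrightarrow> Re z > 0" "bounded D"
  shows "stieltjes_approximable D (\<lambda>z. z * g z)"
  unfolding stieltjes_approximable_def
proof (intro allI impI)
  fix e :: real assume "e > 0"
  obtain R where R: "R > 0" "\<And>z. z \<in> D \<Longrightarrow> norm z \<le> R" using assms(3) unfolding bounded_pos by blast
  have e: "e / (2*R) > 0" using \<open>e > 0\<close> R by simp
  obtain v where v: "weight v" "\<And>z. z\<in>D \<Longrightarrow> norm (stieltjes v z - g z) < e/(2*R)"
    using assms(1) e unfolding stieltjes_approximable_def by metis
  define m where "m = integral UNIV v"
  have "stieltjes_approximable D (\<lambda>z. m * 1)"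
    using stieltjes_approximable_cmult[OF stieltjes_approximable_one[OF assms(2,3)]] .
  then obtain u where u: "weight u" "\<And>z. z\<in>D \<Longrightarrow> norm (stieltjes u z - m) < e/2"
    using \<open>e > 0\<close> unfolding stieltjes_approximable_def by (metis half_gt_zero mult.right_neutral)
  have v': "weight (\<lambda>b. - of_real b * v b)"
    using v(1) by (intro weight_mult continuous_intros)
  have "norm (stieltjes (\<lambda>b. u b + - of_real b * v b) z - z * g z) < e" if "z \<in> D" for z
  proof -
    have "stieltjes (\<lambda>b. u b + - of_real b * v b) z - z * g z
        = (stieltjes u z - m) + z * (stieltjes v z - g z)"
      using stieltjes_add[OF u(1) v'] stieltjes_times[OF v(1)] assms(2)[OF that]
      by (simp add: algebra_simps m_def)
    moreover have "norm (z * (stieltjes v z - g z)) \<le> R * (e / (2*R))"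
      unfolding norm_mult using R v(2)[OF that] that by (intro mult_mono) auto
    ultimately show ?thesis
      using norm_triangle_lt[of "stieltjes u z - m" "z * (stieltjes v z - g z)" e] u(2)[OF that] R by simp
  qed
  then show "\<exists>w. weight w \<and> (\<forall>z\<in>D. norm (stieltjes w z - z * g z) < e)"
    using weight_add[OF u(1) v'] by blast
qed

text \<open>Horner's scheme builds every polynomial from constants, sums and multiplication by
  \<open>z\<close>, all of which preserve approximability.\<close>

lemma stieltjes_approximable_poly:
  assumes "\<And>z. z \<in> D \<Longrightarrow> Re z > 0" "bounded D"
  shows "stieltjes_approximable D (poly p)"
proof (induction p)
  case 0
  then show ?case
    using stieltjes_approximable_cmult[OF stieltjes_approximable_one[OF assms], of 0] by simp
next
  case (pCons a p)
  have "stieltjes_approximable D (\<lambda>z. a * 1 + z * poly p z)"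
    by (intro stieltjes_approximable_add stieltjes_approximable_times pCons assms
        stieltjes_approximable_cmult stieltjes_approximable_one)
  then show ?case by simp
qed

text \<open>The approximants are Taylor partial sums at \<open>c\<close>. The series converges at a
  point of distance \<open>r'\<close> with \<open>r < r' < R\<close>, so the radius of convergence
  exceeds \<open>r\<close> and convergence on the smaller disc is uniform.\<close>

lemma holomorphic_poly_approx:
  assumes "f holomorphic_on ball c R" "r < R" "0 < e"
  obtains p where "\<And>z. z \<in> cball c r \<Longrightarrow> norm (poly p z - f z) < e"
\<comment> \<open>For \<open>r < 0\<close> the disc is empty and any polynomial serves.\<close>
proof (cases "r < 0")
  case False
  define a where "a = (\<lambda>n. (deriv ^^ n) f c / fact n)"
  have sums: "(\<lambda>n. a n * (z - c) ^ n) sums f z" if "z \<in> ball c R" for z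
    using holomorphic_power_series[OF assms(1) that] by (simp add: a_def)
  have "ereal r < conv_radius a"
  proof -
    obtain r' where r': "r < r'" "r' < R" using assms(2) dense by blast
    have "c + of_real r' \<in> ball c R" using r' False by (auto simp: dist_norm)
    from sums[OF this] have "summable (\<lambda>n. a n * of_real r' ^ n)" by (auto simp: sums_iff)
    from conv_radius_geI[OF this] have "ereal \<bar>r'\<bar> \<le> conv_radius a" by simp
    moreover have "ereal r < ereal \<bar>r'\<bar>" using r' by simp
    ultimately show ?thesis by (rule less_le_trans[rotated])
  qed
  from powser_uniform_limit[OF this, of c] assms(3)
  have "\<forall>\<^sub>F n in sequentially. \<forall>z\<in>cball c r. dist (\<Sum>i<n. a i * (z - c) ^ i) (\<Sum>i. a i * (z - c) ^ i) < e"
    unfolding uniform_limit_iff by blast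
  then obtain n where n: "\<And>z. z\<in>cball c r \<Longrightarrow> dist (\<Sum>i<n. a i * (z - c) ^ i) (\<Sum>i. a i * (z - c) ^ i) < e"
    unfolding eventually_sequentially by (meson order_refl)
  show thesis
  proof (rule that[of "\<Sum>i<n. Polynomial.smult (a i) ([:-c, 1:] ^ i)"])
    fix z assume z: "z \<in> cball c r"
    then have "(\<Sum>i. a i * (z - c) ^ i) = f z" using sums[of z] assms(2) by (auto simp: sums_iff)
    then show "norm (poly (\<Sum>i<n. Polynomial.smult (a i) ([:-c, 1:] ^ i)) z - f z) < e"
      using n[OF z] by (simp add: dist_norm poly_sum)
  qed
qed (use that[of 0] in auto)

text \<open>The condition \<open>r < Re c\<close> places the closed disc in the right half-plane, so
  a Taylor polynomial close to \<open>f\<close> can itself be approximated by a transform.\<close>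

lemma stieltjes_approximable_holomorphic:
  assumes "f holomorphic_on ball c R" "r < R" "r < Re c"
  shows "stieltjes_approximable (cball c r) f"
  unfolding stieltjes_approximable_def
proof (intro allI impI)
  fix e :: real assume "e > 0"
  then have e: "e/2 > 0" by simp
  have pos: "Re z > 0" if "z \<in> cball c r" for z
    using complex_Re_le_cmod[of "c - z"] assms(3) that by (auto simp: dist_norm)
  obtain p where p: "\<And>z. z \<in> cball c r \<Longrightarrow> norm (poly p z - f z) < e/2"
    using holomorphic_poly_approx[OF assms(1,2) e] by blast
  obtain w where w: "weight w" "\<And>z. z \<in> cball c r \<Longrightarrow> norm (stieltjes w z - poly p z) < e/2"
    using stieltjes_approximable_poly[of "cball c r" p] pos e unfolding stieltjes_approximable_def
    by (metis bounded_cball)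
  have "norm (stieltjes w z - f z) < e" if "z \<in> cball c r" for z
    using norm_triangle_lt[of "stieltjes w z - poly p z" "poly p z - f z" e] p[OF that] w(2)[OF that] by simp
  then show "\<exists>w. weight w \<and> (\<forall>z\<in>cball c r. norm (stieltjes w z - f z) < e)"
    using w(1) by blast
qed

section \<open>Approximation together with derivatives\<close>

lemma nth_deriv_on_0 [simp]: "nth_deriv_on S 0 f = f"
  by (simp add: nth_deriv_on_def)

lemma nth_deriv_on_Suc:
  "nth_deriv_on S (Suc n) f = (\<lambda>x. vector_derivative (nth_deriv_on S n f) (at x within S))"
  by (simp add: nth_deriv_on_def)

text \<open>Carrying the derivatives as explicit witnesses \<open>F 0, ..., F k\<close> avoids
  calculating with iterated \<open>vector_derivative\<close>, which obeys the usual rules only where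
  derivatives exist.\<close>

definition deriv_seq :: "nat \<Rightarrow> (nat \<Rightarrow> real \<Rightarrow> real) \<Rightarrow> bool" where
  "deriv_seq k F \<longleftrightarrow>
     (\<forall>i<k. \<forall>x\<in>{0..1}. (F i has_vector_derivative F (Suc i) x) (at x within {0..1})) \<and>
     continuous_on {0..1} (F k)"

lemma deriv_seqD: "deriv_seq k F \<Longrightarrow> i < k \<Longrightarrow> x \<in> {0..1} \<Longrightarrow>
    (F i has_vector_derivative F (Suc i) x) (at x within {0..1})"
  by (simp add: deriv_seq_def)

lemma deriv_seq_continuous:
  assumes "deriv_seq k F" "i \<le> k"
  shows "continuous_on {0..1} (F i)"
proof (cases "i = k")
  case False
  with assms have "(F i has_vector_derivative F (Suc i) x) (at x within {0..1})" if "x \<in> {0..1}" for x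
    using deriv_seqD[of k F i x] that by simp
  then show ?thesis
    using has_vector_derivative_continuous continuous_on_eq_continuous_within by metis
qed (use assms in \<open>simp add: deriv_seq_def\<close>)

text \<open>Derivatives relative to a nondegenerate closed interval are unique, also at its
  endpoints, and depend only on values in the interval. Induction on \<open>i\<close> therefore
  identifies the witnesses with the iterated derivatives.\<close>

lemma deriv_seq_nth_deriv_on:
  assumes "deriv_seq k F" "\<And>x. x \<in> {0..1} \<Longrightarrow> F 0 x = f x" "i \<le> k" "x \<in> {0..1}"
  shows "nth_deriv_on {0..1} i f x = F i x"
  using assms(3,4)
proof (induction i arbitrary: x)
  case (Suc i)
  have "(F i has_vector_derivative F (Suc i) x) (at x within {0..1})"
    using deriv_seqD[OF assms(1), of i x] Suc.prems by simp
  then have "(nth_deriv_on {0..1} i f has_vector_derivative F (Suc i) x) (at x within {0..1})"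
    using Suc by (intro has_vector_derivative_transform[of x "{0..1}" "nth_deriv_on {0..1} i f" "F i"]) auto
  then show ?case
    using Suc.prems vector_derivative_within_closed_interval[of 0 1 x] by (simp add: nth_deriv_on_Suc)
qed (simp add: assms(2))

lemma deriv_seq_imp_Ck_on:
  assumes "deriv_seq k F" "\<And>x. x \<in> {0..1} \<Longrightarrow> F 0 x = f x"
  shows "f \<in> Ck_on k {0..1}"
proof -
  have eq: "nth_deriv_on {0..1} i f x = F i x" if "i \<le> k" "x \<in> {0..1}" for i x
    using deriv_seq_nth_deriv_on[of k F f i x] assms that by blast
  have "nth_deriv_on {0..1} i f differentiable (at x within {0..1})" if "i < k" "x \<in> {0..1}" for i x
  proof -
    have "(nth_deriv_on {0..1} i f has_vector_derivative F (Suc i) x) (at x within {0..1})"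
      using that eq by (intro has_vector_derivative_transform[OF _ _ deriv_seqD[OF assms(1)]]) auto
    then show ?thesis by (rule differentiableI_vector)
  qed
  moreover have "continuous_on {0..1} (nth_deriv_on {0..1} i f)" if "i \<le> k" for i
    using deriv_seq_continuous[OF assms(1) that] by (rule continuous_on_eq) (simp add: eq[OF that])
  ultimately show ?thesis
    by (simp add: Ck_on_def differentiable_on_def)
qed

lemma Ck_on_imp_deriv_seq:
  assumes "f \<in> Ck_on k {0..1}"
  shows "deriv_seq k (\<lambda>i. nth_deriv_on {0..1} i f)"
  using assms unfolding Ck_on_def deriv_seq_def differentiable_on_def nth_deriv_on_Suc
  by (auto simp: vector_derivative_works)

lemma deriv_seq_diff: "deriv_seq k F \<Longrightarrow> deriv_seq k G \<Longrightarrow> deriv_seq k (\<lambda>i x. F i x - G i x)"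
  unfolding deriv_seq_def by (auto intro: has_vector_derivative_diff continuous_on_diff)

lemma Ck_norm_le:
  assumes "deriv_seq k F" "\<And>x. x \<in> {0..1} \<Longrightarrow> F 0 x = f x"
    and "\<And>i x. i \<le> k \<Longrightarrow> x \<in> {0..1} \<Longrightarrow> \<bar>F i x\<bar> \<le> e"
  shows "Ck_norm k {0..1} f \<le> real (Suc k) * e"
proof -
  have "(SUP x\<in>{0..1}. \<bar>nth_deriv_on {0..1} i f x\<bar>) \<le> e" if "i \<le> k" for i
    using assms(3)[OF that] deriv_seq_nth_deriv_on[of k F f i] assms(1,2) that by (intro cSUP_least) auto
  then have "Ck_norm k {0..1} f \<le> (\<Sum>i\<le>k. e)"
    unfolding Ck_norm_def by (intro sum_mono) auto
  then show ?thesis by simp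
qed

section \<open>Weierstrass approximation together with derivatives\<close>

lemma poly_antiderivative: "\<exists>q :: real poly. pderiv q = p \<and> poly q a = c"
proof -
  define r where "r = (\<Sum>i\<le>degree p. monom (coeff p i / real (Suc i)) (Suc i))"
  have "pderiv r = (\<Sum>i\<le>degree p. monom (coeff p i) i)"
    using higher_pderiv_sum[of 1 "\<lambda>i. monom (coeff p i / real (Suc i)) (Suc i)" "{..degree p}"]
    by (simp add: r_def pderiv_monom del: of_nat_Suc)
  also have "\<dots> = p" by (rule poly_as_sum_of_monoms)
  finally have "pderiv (r + [:c - poly r a:]) = p"
    by (simp add: pderiv_add pderiv_pCons)
  then show ?thesis
    by (intro exI[of _ "r + [:c - poly r a:]"]) simp
qed

text \<open>Weierstrass approximation handles the top derivative. Each induction step passes to an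
  antiderivative with the same value at 0; as the interval has length 1, integration does not
  enlarge the error.\<close>

lemma deriv_seq_poly_approx:
  assumes "deriv_seq k F" "e > 0"
  shows "\<exists>p. \<forall>i\<le>k. \<forall>x\<in>{0..1}. \<bar>F i x - poly ((pderiv ^^ i) p) x\<bar> < e"
  using assms
proof (induction k arbitrary: F e)
  case 0
  then have "continuous_on {0..1} (F 0)" by (simp add: deriv_seq_def)
  then obtain g where g: "real_polynomial_function g" "\<And>x. x \<in> {0..1} \<Longrightarrow> \<bar>F 0 x - g x\<bar> < e"
    using Stone_Weierstrass_real_polynomial_function[of "{0..1}" "F 0" e] \<open>e > 0\<close> by auto
  obtain a n where a: "g = (\<lambda>x. \<Sum>i\<le>n. a i * x ^ i)"
    using g(1) real_polynomial_function_iff_sum by blast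
  then have "poly (\<Sum>i\<le>n. monom (a i) i) = g"
    by (simp add: fun_eq_iff poly_sum poly_monom)
  then show ?case using g(2) by (intro exI[of _ "\<Sum>i\<le>n. monom (a i) i"]) simp
next
  case (Suc k)
  have "deriv_seq k (\<lambda>i. F (Suc i))" using Suc.prems(1) by (auto simp: deriv_seq_def)
  then obtain p where p: "\<And>i x. i \<le> k \<Longrightarrow> x \<in> {0..1} \<Longrightarrow> \<bar>F (Suc i) x - poly ((pderiv ^^ i) p) x\<bar> < e/2"
    using Suc.IH[of "\<lambda>i. F (Suc i)" "e/2"] Suc.prems(2) half_gt_zero by blast
  obtain q where q: "pderiv q = p" "poly q 0 = F 0 0"
    using poly_antiderivative by blast
  have "\<bar>F i x - poly ((pderiv ^^ i) q) x\<bar> < e" if i: "i \<le> Suc k" and x: "x \<in> {0..1}" for i x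
  proof (cases i)
    case 0
    \<comment> \<open>Mean value inequality for the error, which vanishes at 0 by the choice of
      \<open>q\<close>. Halving \<open>e\<close> absorbs the loss of strictness.\<close>
    have "norm ((F 0 x - poly q x) - (F 0 0 - poly q 0)) \<le> e/2 * norm (x - 0)"
    proof (rule differentiable_bound[of "{0..1}"])
      fix y :: real assume y: "y \<in> {0..1}"
      have "(poly q has_vector_derivative poly p y) (at y within {0..1})"
        using poly_DERIV[of q y] q
        by (auto simp: has_real_derivative_iff_has_vector_derivative intro: has_vector_derivative_at_within)
      then have "((\<lambda>x. F 0 x - poly q x) has_vector_derivative (F (Suc 0) y - poly p y)) (at y within {0..1})"
        using Suc.prems(1) y by (intro has_vector_derivative_diff deriv_seqD[of "Suc k"]) auto
      then show "((\<lambda>x. F 0 x - poly q x) has_derivative (\<lambda>h. h *\<^sub>R (F (Suc 0) y - poly p y))) (at y within {0..1})"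
        by (simp add: has_vector_derivative_def)
      show "onorm (\<lambda>h. h *\<^sub>R (F (Suc 0) y - poly p y)) \<le> e/2"
      proof (rule onorm_le)
        fix h :: real
        have "\<bar>F (Suc 0) y - poly p y\<bar> \<le> e/2" using p[of 0 y] y by simp
        then have "\<bar>h\<bar> * \<bar>F (Suc 0) y - poly p y\<bar> \<le> \<bar>h\<bar> * (e/2)" by (rule mult_left_mono) simp
        then show "norm (h *\<^sub>R (F (Suc 0) y - poly p y)) \<le> e/2 * norm h"
          by (simp add: abs_mult mult.commute)
      qed
    qed (use x in auto)
    also have "e/2 * norm (x - 0) \<le> e/2 * 1" using x Suc.prems(2) by (intro mult_left_mono) auto
    also have "\<dots> < e" using Suc.prems(2) by simp
    finally show ?thesis using q(2) 0 by simp
  next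
    case (Suc j)
    then show ?thesis
      using p[of j x] i x q(1) Suc.prems Suc \<open>e > 0\<close> by (simp add: funpow_swap1)
  qed
  then show ?case by blast
qed

text \<open>On the real line the chain rule has inner derivative 1, and \<open>Re\<close>, being
  bounded linear, commutes with real differentiation.\<close>

lemma deriv_seq_Re:
  assumes "f holomorphic_on A" "open A" "\<And>x. x \<in> {0..1} \<Longrightarrow> of_real (x + c) \<in> A"
  shows "deriv_seq k (\<lambda>i x. Re ((deriv ^^ i) f (of_real (x + c))))"
proof -
  have d: "((\<lambda>x. Re ((deriv ^^ i) f (of_real (x + c)))) has_vector_derivative
        Re ((deriv ^^ Suc i) f (of_real (x + c)))) (at x within {0..1})" if "x \<in> {0..1}" for i x
  proof -
    have "((deriv ^^ i) f has_field_derivative (deriv ^^ Suc i) f (of_real (x + c))) (at (of_real (x + c)))"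
      by (rule has_field_derivative_higher_deriv[OF assms(1,2) assms(3)[OF that]])
    moreover have "((\<lambda>x. complex_of_real (x + c)) has_vector_derivative 1) (at x)"
      by (auto intro!: derivative_eq_intros)
    ultimately have "((\<lambda>x. (deriv ^^ i) f (of_real (x + c))) has_vector_derivative
        1 * (deriv ^^ Suc i) f (of_real (x + c))) (at x)"
      using field_vector_diff_chain_at[of "\<lambda>x. complex_of_real (x + c)" 1 x] by (simp add: o_def)
    then have "((\<lambda>x. Re ((deriv ^^ i) f (of_real (x + c)))) has_vector_derivative
        Re ((deriv ^^ Suc i) f (of_real (x + c)))) (at x)"
      using bounded_linear.has_vector_derivative[OF bounded_linear_Re] by fastforce
    then show ?thesis by (rule has_vector_derivative_at_within)
  qed
  then have "continuous_on {0..1} (\<lambda>x. Re ((deriv ^^ k) f (of_real (x + c))))"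
    using has_vector_derivative_continuous continuous_on_eq_continuous_within by metis
  with d show ?thesis by (simp add: deriv_seq_def)
qed

lemma deriv_seq_poly: "deriv_seq k (\<lambda>i. poly ((pderiv ^^ i) q))"
proof -
  have "(poly ((pderiv ^^ i) q) has_vector_derivative poly ((pderiv ^^ Suc i) q) x) (at x within {0..1})" for i x
    using poly_DERIV[of "(pderiv ^^ i) q" x]
    by (auto simp: has_real_derivative_iff_has_vector_derivative intro: has_vector_derivative_at_within)
  then show ?thesis by (auto simp: deriv_seq_def intro!: continuous_intros)
qed

lemma poly_of_real: "poly (map_poly of_real q) (of_real x) = complex_of_real (poly q x)"
  by (induction q) (simp_all add: map_poly_pCons)

lemma stieltjes_powr_holomorphic:
  assumes "weight w"
  shows "(\<lambda>z. z powr of_real r * stieltjes w z) holomorphic_on {z. Re z > 0}"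
  by (intro holomorphic_intros stieltjes_holomorphic assms) (auto simp: complex_nonpos_Reals_iff)

text \<open>
  Uniform closeness of holomorphic functions on a complex neighbourhood of \<open>[2, 3]\<close> controls
  all derivatives by Cauchy's inequality.
\<close>

lemma stieltjes_powr_approx_poly:
  fixes q :: "real poly"
  assumes "e > 0" "s < 1"
  shows "\<exists>w. weight w \<and> (\<forall>i\<le>k. \<forall>x\<in>{0..1}.
    \<bar>Re ((deriv ^^ i) (\<lambda>z. z powr of_real (s - 1) * stieltjes w z) (of_real (x + 2)))
      - poly ((pderiv ^^ i) q) x\<bar> < e)"
proof -
  let ?H = "{z. Re z > 0}"
  \<comment> \<open>The complex extension of \<open>q\<close>, recentred so that the point
    \<open>x + 2\<close> corresponds to \<open>x\<close>.\<close>
  define Q :: "complex \<Rightarrow> complex" where "Q = (\<lambda>z. poly (map_poly of_real q) (z - 2))"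
  \<comment> \<open>Cauchy's inequality on circles of radius 1/2 costs the factor
    \<open>fact i * 2 ^ i\<close>; \<open>M\<close> dominates it for all orders up to
    \<open>k\<close>.\<close>
  define M :: real where "M = (\<Sum>i\<le>k. fact i * 2 ^ i)"
  have M: "fact i * 2 ^ i \<le> M" if "i \<le> k" for i
    unfolding M_def using that by (intro member_le_sum) auto
  have "M > 0" using M[of 0] by simp
  define d where "d = e / (2 * M)"
  have "d > 0" using \<open>e > 0\<close> \<open>M > 0\<close> by (simp add: d_def)
  have Qhol: "Q holomorphic_on A" for A
    unfolding Q_def by (intro holomorphic_intros)
  have ball: "z \<in> ?H" if "z \<in> ball (5/2) (5/2)" for z
    using complex_Re_le_cmod[of "5/2 - z"] that by (auto simp: dist_norm)
  \<comment> \<open>The target is divided by \<open>z powr (s - 1)\<close> in advance, so that a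
    bare transform is to be approximated. The disc of centre and radius 5/2 lies in the half-plane
    where the power is holomorphic.\<close>
  have "(\<lambda>z. Q z * z powr of_real (1 - s)) holomorphic_on ball (5/2) (5/2)"
    using ball by (intro holomorphic_intros Qhol) (force simp: complex_nonpos_Reals_iff)
  then have "stieltjes_approximable (cball (5/2) 1) (\<lambda>z. Q z * z powr of_real (1 - s))"
    by (rule stieltjes_approximable_holomorphic) auto
  then obtain w where w: "weight w"
    "\<And>z. z \<in> cball (5/2) 1 \<Longrightarrow> norm (stieltjes w z - Q z * z powr of_real (1 - s)) < d"
    using \<open>d > 0\<close> unfolding stieltjes_approximable_def by blast
  define V where "V = (\<lambda>z. z powr of_real (s - 1) * stieltjes w z)"
  have Vhol: "V holomorphic_on ?H"
    unfolding V_def by (rule stieltjes_powr_holomorphic[OF w(1)])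
  have opH: "open ?H" by (rule open_halfspace_Re_gt)
  \<comment> \<open>On the disc \<open>norm z \<ge> 1\<close>, so restoring the factor
    \<open>z powr (s - 1)\<close> does not enlarge the error, as \<open>s < 1\<close>.\<close>
  have close: "norm (V z - Q z) \<le> d" if "z \<in> cball (5/2) 1" for z
  proof -
    have Re: "Re z \<ge> 3/2"
      using complex_Re_le_cmod[of "5/2 - z"] that by (auto simp: dist_norm)
    then have z: "z \<noteq> 0" "norm z \<ge> 1" using complex_Re_le_cmod[of z] by auto
    have "z powr of_real (s - 1) * z powr of_real (1 - s) = 1"
      using z(1) by (simp flip: powr_add)
    then have "V z - Q z = z powr of_real (s - 1) * (stieltjes w z - Q z * z powr of_real (1 - s))"
      by (simp add: V_def algebra_simps)
    then have "norm (V z - Q z) = norm z powr (s - 1) * norm (stieltjes w z - Q z * z powr of_real (1 - s))"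
      by (simp add: norm_mult norm_powr_real_powr')
    also have "\<dots> \<le> 1 * d"
    proof (intro mult_mono)
      show "norm z powr (s - 1) \<le> 1"
        using powr_mono[of "s - 1" 0 "norm z"] z assms(2) by simp
    qed (use w(2)[OF that] in auto)
    finally show ?thesis by simp
  qed
  have "\<bar>Re ((deriv ^^ i) V (of_real (x + 2))) - poly ((pderiv ^^ i) q) x\<bar> < e"
    if i: "i \<le> k" and x: "x \<in> {0..1}" for i x
  proof -
    let ?z = "complex_of_real (x + 2)"
    have in_H: "complex_of_real (y + 2) \<in> ?H" if "y \<in> {0..1}" for y using that by auto
    have Q0: "Re (Q (of_real (y + 2))) = poly q y" for y
      by (simp add: Q_def poly_of_real)
    \<comment> \<open>Both derivative sequences start from \<open>poly q\<close>, so they agree by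
      uniqueness of the iterated derivatives.\<close>
    have "Re ((deriv ^^ i) Q ?z) = nth_deriv_on {0..1} i (poly q) x"
      using deriv_seq_nth_deriv_on[OF deriv_seq_Re[OF Qhol opH in_H, of k], of "poly q" i x] Q0 i x by simp
    also have "\<dots> = poly ((pderiv ^^ i) q) x"
      using deriv_seq_nth_deriv_on[OF deriv_seq_poly[of k q], of "poly q" i x] i x by simp
    finally have Q: "Re ((deriv ^^ i) Q ?z) = poly ((pderiv ^^ i) q) x" .
    \<comment> \<open>A point of \<open>[2, 3]\<close> is within 1/2 of the centre 5/2, which leaves
      room for a Cauchy circle of radius 1/2.\<close>
    have sub: "cball ?z (1/2) \<subseteq> cball (5/2) 1"
    proof
      fix z assume "z \<in> cball ?z (1/2)"
      moreover have "dist ?z (5/2) \<le> 1/2"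
      proof -
        have "?z - 5/2 = of_real (x - 1/2)" by simp
        then show ?thesis using x by (simp only: dist_norm norm_of_real) (auto simp: abs_le_iff field_simps)
      qed
      ultimately show "z \<in> cball (5/2) 1"
        using dist_triangle[of "5/2" z ?z] by (simp add: dist_commute)
    qed
    have "cball (5/2) 1 \<subseteq> ball (5/2 :: complex) (5/2)" by auto
    then have sub_H: "cball ?z (1/2) \<subseteq> ?H" using sub ball by blast
    have hol: "(\<lambda>z. V z - Q z) holomorphic_on ?H" by (intro holomorphic_intros Vhol Qhol)
    have "norm ((deriv ^^ i) (\<lambda>z. V z - Q z) ?z) \<le> fact i * d / (1/2) ^ i"
    proof (rule Cauchy_inequality)
      show "(\<lambda>z. V z - Q z) holomorphic_on ball ?z (1/2)"
        using sub_H by (intro holomorphic_on_subset[OF hol]) (meson ball_subset_cball subset_trans)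
      show "continuous_on (cball ?z (1/2)) (\<lambda>z. V z - Q z)"
        using holomorphic_on_imp_continuous_on[OF hol] sub_H continuous_on_subset by blast
      show "norm (V z - Q z) \<le> d" if "norm (?z - z) = 1/2" for z
        using subsetD[OF sub, of z] that by (intro close) (simp add: dist_norm)
    qed simp
    also have "\<dots> = fact i * 2 ^ i * d" by (simp add: power_divide)
    also have "\<dots> \<le> M * d" using M[OF i] \<open>d > 0\<close> by (intro mult_right_mono) auto
    also have "\<dots> < e" using \<open>M > 0\<close> \<open>e > 0\<close> by (simp add: d_def)
    finally have "norm ((deriv ^^ i) V ?z - (deriv ^^ i) Q ?z) < e"
      using higher_deriv_diff[OF Vhol Qhol opH in_H[OF x], of i] by simp
    then show ?thesis
      using abs_Re_le_cmod[of "(deriv ^^ i) V ?z - (deriv ^^ i) Q ?z"] Q by simp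
  qed
  then show ?thesis using w(1) unfolding V_def by blast
qed

section \<open>Integrals and translations\<close>

text \<open>Splitting \<open>\<bar>f\<bar>\<close> at height \<open>N\<close> leaves an excess of small total integral and a part bounded by \<open>N\<close>.\<close>

lemma abs_continuous_integral:
  assumes f: "f absolutely_integrable_on {a..b}"
  shows "abs_continuous_on_interval a b (\<lambda>x. c + integral {a..x} f)"
  unfolding abs_continuous_on_interval_def
proof (intro allI impI)
  fix e :: real assume "e > 0"
  define g where "g = (\<lambda>x. indicat_real {a..b} x * \<bar>f x\<bar>)"
  have g: "integrable lebesgue g"
    using set_integrable_abs[OF f] by (simp add: set_integrable_def g_def)
  have g0: "g x \<ge> 0" for x by (simp add: g_def)
  have trunc: "integrable lebesgue (\<lambda>x. g x - min (g x) (real N))" for N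
    by (rule Bochner_Integration.integrable_bound[OF g]) (use g g0 in \<open>auto simp: min_def\<close>)
  \<comment> \<open>The excess of \<open>g\<close> over height \<open>N\<close> is eventually 0 at
    each point and is dominated by \<open>g\<close>.\<close>
  have "(\<lambda>N. LINT x|lebesgue. g x - min (g x) (real N)) \<longlonglongrightarrow> integral\<^sup>L lebesgue (\<lambda>x::real. 0::real)"
  proof (rule integral_dominated_convergence[where w = g and f = "\<lambda>_. 0" and s = "\<lambda>N x. g x - min (g x) (real N)"])
    show "AE x in lebesgue. (\<lambda>N. g x - min (g x) (real N)) \<longlonglongrightarrow> 0"
    proof (rule AE_I2)
      fix x
      have "\<forall>\<^sub>F N in sequentially. g x \<le> real N" by (rule eventually_sequentiallyI[of "nat \<lceil>g x\<rceil>"]) linarith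
      then show "(\<lambda>N. g x - min (g x) (real N)) \<longlonglongrightarrow> 0"
        by (rule tendsto_eventually[OF eventually_mono]) simp
    qed
    show "AE x in lebesgue. norm (g x - min (g x) (real N)) \<le> g x" for N
      using g0 by (auto simp: min_def)
  qed (use g trunc in \<open>auto intro: borel_measurable_integrable\<close>)
  then have "\<forall>\<^sub>F N in sequentially. (LINT x|lebesgue. g x - min (g x) (real N)) < e/2"
    using \<open>e > 0\<close> by (intro order_tendstoD) auto
  then obtain N where N: "(LINT x|lebesgue. g x - min (g x) (real N)) < e/2"
    unfolding eventually_sequentially by blast
  define h where "h = (\<lambda>x. g x - min (g x) (real N))"
  have h: "integrable lebesgue h" "h x \<ge> 0" for x unfolding h_def using trunc by auto
  show "\<exists>\<delta>>0. \<forall>(n::nat) l r. (\<forall>i<n. a \<le> l i \<and> l i \<le> r i \<and> r i \<le> b) \<longrightarrow>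
          disjoint_family_on (\<lambda>i. {l i<..<r i}) {..<n} \<longrightarrow> (\<Sum>i<n. r i - l i) < \<delta> \<longrightarrow>
          (\<Sum>i<n. \<bar>(c + integral {a..r i} f) - (c + integral {a..l i} f)\<bar>) < e"
  \<comment> \<open>Total length below this \<delta> makes the part bounded by \<open>N\<close>
    contribute at most \<open>e/2\<close>; the summand 1 covers \<open>N = 0\<close>.\<close>
  proof (intro exI[of _ "e / (2 * (real N + 1))"] conjI allI impI)
    show "e / (2 * (real N + 1)) > 0" using \<open>e > 0\<close> by simp
    fix n :: nat and l r :: "nat \<Rightarrow> real"
    assume lr: "\<forall>i<n. a \<le> l i \<and> l i \<le> r i \<and> r i \<le> b"
      and disj: "disjoint_family_on (\<lambda>i. {l i<..<r i}) {..<n}"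
      and small: "(\<Sum>i<n. r i - l i) < e / (2 * (real N + 1))"
    have hi: "integrable lebesgue (\<lambda>x. indicat_real {l i<..<r i} x * h x)" for i
      using integrable_mult_indicator[of "{l i<..<r i}" lebesgue h] h(1) by simp
    have le: "\<bar>(c + integral {a..r i} f) - (c + integral {a..l i} f)\<bar>
        \<le> (LINT x|lebesgue. indicat_real {l i<..<r i} x * h x) + real N * (r i - l i)" if "i < n" for i
    proof -
      have lri: "a \<le> l i" "l i \<le> r i" "r i \<le> b" using lr that by auto
      have fi: "f absolutely_integrable_on {p..q}" if "a \<le> p" "q \<le> b" for p q
        using absolutely_integrable_on_subinterval[OF f] that by auto
      have fo: "f absolutely_integrable_on {l i<..<r i}"
        by (rule set_integrable_subset[OF fi[of "l i" "r i"]]) (use lri in auto)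
      have ii: "integrable lebesgue (indicat_real {l i<..<r i})"
        using lri by (intro integrable_real_indicator) auto
      have "integral {a..l i} f + integral {l i..r i} f = integral {a..r i} f"
        using lri fi[of a "r i"] by (intro Henstock_Kurzweil_Integration.integral_combine set_lebesgue_integral_eq_integral(1)) auto
      then have "\<bar>(c + integral {a..r i} f) - (c + integral {a..l i} f)\<bar> = \<bar>integral {l i..r i} f\<bar>" by simp
      also have "integral {l i..r i} f = integral {l i<..<r i} f"
        by (simp add: integral_open_interval_real)
      also have "\<dots> = (LINT x:{l i<..<r i}|lebesgue. f x)"
        by (rule set_lebesgue_integral_eq_integral(2)[OF fo, symmetric])
      also have "\<bar>\<dots>\<bar> \<le> (LINT x:{l i<..<r i}|lebesgue. \<bar>f x\<bar>)"
        using set_integral_norm_bound[OF fo] by simp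
      also have "\<dots> \<le> (LINT x|lebesgue. indicat_real {l i<..<r i} x * h x + real N * indicat_real {l i<..<r i} x)"
        unfolding set_lebesgue_integral_def
      proof (rule integral_mono)
        have "set_integrable lebesgue {l i<..<r i} (\<lambda>x. \<bar>f x\<bar>)"
          using fo by (rule set_integrable_abs)
        then show "integrable lebesgue (\<lambda>x. indicat_real {l i<..<r i} x *\<^sub>R \<bar>f x\<bar>)"
          by (simp add: set_integrable_def)
        show "integrable lebesgue (\<lambda>x. indicat_real {l i<..<r i} x * h x + real N * indicat_real {l i<..<r i} x)"
          using hi ii by (intro Bochner_Integration.integrable_add integrable_mult_right) auto
        show "indicat_real {l i<..<r i} x *\<^sub>R \<bar>f x\<bar>
            \<le> indicat_real {l i<..<r i} x * h x + real N * indicat_real {l i<..<r i} x" for x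
          using lri by (auto simp: indicator_def h_def g_def)
      qed
      also have "\<dots> = (LINT x|lebesgue. indicat_real {l i<..<r i} x * h x) + real N * (r i - l i)"
        using hi ii lri by (subst Bochner_Integration.integral_add) auto
      finally show ?thesis .
    qed
    have "(\<Sum>i<n. LINT x|lebesgue. indicat_real {l i<..<r i} x * h x)
        = (LINT x|lebesgue. (\<Sum>i<n. indicat_real {l i<..<r i} x * h x))"
      using hi by (intro Bochner_Integration.integral_sum[symmetric]) auto
    also have "\<dots> \<le> (LINT x|lebesgue. h x)"
    proof (rule integral_mono)
      fix x
      \<comment> \<open>Disjointness turns the sum of indicators into the indicator of the union, so
        the excess is counted at most once.\<close>
      have "(\<Sum>i<n. indicat_real {l i<..<r i} x * h x) = indicat_real (\<Union>i<n. {l i<..<r i}) x * h x"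
        using indicator_UN_disjoint[OF _ disj, of x, where ?'c = real] by (simp flip: sum_distrib_right)
      also have "\<dots> \<le> h x" using h(2)[of x] by (simp add: indicator_def)
      finally show "(\<Sum>i<n. indicat_real {l i<..<r i} x * h x) \<le> h x" .
    qed (intro Bochner_Integration.integrable_sum hi h(1))+
    also have "\<dots> < e/2" using N by (simp add: h_def)
    finally have 1: "(\<Sum>i<n. LINT x|lebesgue. indicat_real {l i<..<r i} x * h x) < e/2" .
    have "real N * (\<Sum>i<n. r i - l i) \<le> real N * (e / (2 * (real N + 1)))"
      using small by (intro mult_left_mono) auto
    also have "\<dots> \<le> e/2" using \<open>e > 0\<close> by (simp add: field_simps)
    finally have 2: "real N * (\<Sum>i<n. r i - l i) \<le> e/2" .
    have "(\<Sum>i<n. \<bar>(c + integral {a..r i} f) - (c + integral {a..l i} f)\<bar>)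
        \<le> (\<Sum>i<n. (LINT x|lebesgue. indicat_real {l i<..<r i} x * h x) + real N * (r i - l i))"
      using le by (intro sum_mono) auto
    also have "\<dots> < e" using 1 2 by (simp add: sum.distrib sum_distrib_left)
    finally show "(\<Sum>i<n. \<bar>(c + integral {a..r i} f) - (c + integral {a..l i} f)\<bar>) < e" .
  qed
qed

text \<open>Continuity on the compact hull \<open>{p..q}\<close> bounds \<open>g\<close>, while
  \<open>\<phi>\<close> may be singular at an end of \<open>S\<close>.\<close>

lemma absolutely_integrable_continuous_mult:
  fixes g \<phi> :: "real \<Rightarrow> real"
  assumes "\<phi> absolutely_integrable_on S" "S \<in> sets lebesgue" "S \<subseteq> {p..q}" "continuous_on {p..q} g"
  shows "(\<lambda>x. g x * \<phi> x) absolutely_integrable_on S"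
proof (rule absolutely_integrable_bounded_measurable_product_real)
  show "g \<in> borel_measurable (lebesgue_on S)"
    using assms continuous_on_subset by (intro continuous_imp_measurable_on_sets_lebesgue) blast+
  have "bounded (g ` {p..q})"
    using assms(4) by (intro compact_imp_bounded compact_continuous_image) auto
  then show "bounded (g ` S)" using assms(3) by (meson bounded_subset image_mono)
qed (use assms in auto)

section \<open>Translation invariance of the Caputo problem\<close>

lemma absolutely_integrable_translation:
  fixes f :: "real \<Rightarrow> real" and a c x b :: real
  shows "(\<lambda>t. f (t + c)) absolutely_integrable_on {a - c<..<x - c} \<and>
           integral {a - c<..<x - c} (\<lambda>t. f (t + c)) = b
         \<longleftrightarrow> f absolutely_integrable_on {a<..<x} \<and> integral {a<..<x} f = b"
proof -
  have "(\<lambda>t. t + c) ` {a - c<..<x - c} = {a<..<x}"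
    by (force simp: image_iff intro: bexI[of _ "_ - c"])
  moreover have "((\<lambda>t. t + c) has_field_derivative 1) (at t within {a - c<..<x - c})" for t
    by (auto intro!: derivative_eq_intros)
  ultimately show ?thesis
    using has_absolute_integral_change_of_variables_1'[of "{a - c<..<x - c}" "\<lambda>t. t + c" "\<lambda>_. 1" f b]
    by simp
qed

lemma abs_continuous_translation:
  assumes "abs_continuous_on_interval a b f"
  shows "abs_continuous_on_interval (a - c) (b - c) (\<lambda>x. f (x + c))"
  unfolding abs_continuous_on_interval_def
proof (intro allI impI)
  fix e :: real assume "e > 0"
  then have "\<exists>d>0. \<forall>(n::nat) l r. (\<forall>i<n. a \<le> l i \<and> l i \<le> r i \<and> r i \<le> b) \<longrightarrow>
        disjoint_family_on (\<lambda>i. {l i<..<r i}) {..<n} \<longrightarrow> (\<Sum>i<n. r i - l i) < d \<longrightarrow>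
        (\<Sum>i<n. \<bar>f (r i) - f (l i)\<bar>) < e"
    by (rule assms[unfolded abs_continuous_on_interval_def, THEN spec, THEN mp])
  then obtain d where d: "d > 0" "\<forall>(n::nat) l r. (\<forall>i<n. a \<le> l i \<and> l i \<le> r i \<and> r i \<le> b) \<longrightarrow>
        disjoint_family_on (\<lambda>i. {l i<..<r i}) {..<n} \<longrightarrow> (\<Sum>i<n. r i - l i) < d \<longrightarrow>
        (\<Sum>i<n. \<bar>f (r i) - f (l i)\<bar>) < e"
    by (elim exE conjE) (rule that)
  show "\<exists>\<delta>>0. \<forall>(n::nat) l r. (\<forall>i<n. a - c \<le> l i \<and> l i \<le> r i \<and> r i \<le> b - c) \<longrightarrow>
        disjoint_family_on (\<lambda>i. {l i<..<r i}) {..<n} \<longrightarrow> (\<Sum>i<n. r i - l i) < \<delta> \<longrightarrow>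
        (\<Sum>i<n. \<bar>f (r i + c) - f (l i + c)\<bar>) < e"
  proof (intro exI[of _ d] conjI allI impI d(1))
    fix n :: nat and l r :: "nat \<Rightarrow> real"
    assume lr: "\<forall>i<n. a - c \<le> l i \<and> l i \<le> r i \<and> r i \<le> b - c"
      and disj: "disjoint_family_on (\<lambda>i. {l i<..<r i}) {..<n}" and small: "(\<Sum>i<n. r i - l i) < d"
    have "disjoint_family_on (\<lambda>i. {l i + c<..<r i + c}) {..<n}"
      unfolding disjoint_family_on_def
    proof (intro ballI impI equals0I)
      fix i j y assume ij: "i \<in> {..<n}" "j \<in> {..<n}" "i \<noteq> j"
        and "y \<in> {l i + c<..<r i + c} \<inter> {l j + c<..<r j + c}"
      then have "y - c \<in> {l i<..<r i} \<inter> {l j<..<r j}" by auto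
      then show False using disj ij unfolding disjoint_family_on_def by blast
    qed
    moreover have "\<forall>i<n. a \<le> l i + c \<and> l i + c \<le> r i + c \<and> r i + c \<le> b"
      using lr by (simp add: algebra_simps)
    moreover have "(\<Sum>i<n. (r i + c) - (l i + c)) < d" using small by simp
    ultimately show "(\<Sum>i<n. \<bar>f (r i + c) - f (l i + c)\<bar>) < e"
      using d(2)[THEN spec, THEN spec, THEN spec, of n "\<lambda>i. l i + c" "\<lambda>i. r i + c"] by blast
  qed
qed

text \<open>Translation is an equivalence between the derivatives of the two functions, so
  \<open>deriv\<close> chooses the same value even where \<open>f\<close> is not differentiable, and
  no exceptional set arises.\<close>

lemma deriv_translation: "deriv (\<lambda>x. f (x + c)) t = deriv f (t + c :: real)"
  unfolding deriv_def using DERIV_shift[of f _ t c] by simp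

lemma C1s_translation:
  assumes "u \<in> C1s a s"
  shows "(\<lambda>x. u (x + c)) \<in> C1s (a - c) s"
  unfolding C1s_def
proof (intro CollectI allI impI conjI)
  fix x assume "x > a - c"
  then have "x + c > a" by simp
  then show "abs_continuous_on_interval (a - c) x (\<lambda>x. u (x + c))"
    using abs_continuous_translation[of a "x + c" u c] assms by (simp add: C1s_def)
  show "(\<lambda>t. deriv (\<lambda>x. u (x + c)) t * (x - t) powr - s) absolutely_integrable_on {a - c<..<x}"
    using assms \<open>x + c > a\<close> absolutely_integrable_translation[where b = "integral {a<..<x + c} (\<lambda>t. deriv u t * (x + c - t) powr - s)" and f = "\<lambda>t. deriv u t * (x + c - t) powr - s" and c = c and a = a and x = "x + c"]
    by (simp add: C1s_def deriv_translation)
qed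

lemma caputo_deriv_translation:
  assumes "u \<in> C1s a s" "x > a - c"
  shows "caputo_deriv (a - c) s (\<lambda>x. u (x + c)) x = caputo_deriv a s u (x + c)"
proof -
  have *: "(\<lambda>t. deriv u t * (x + c - t) powr - s) absolutely_integrable_on {a<..<x + c}"
    using assms by (simp add: C1s_def)
  then show ?thesis
    using * absolutely_integrable_translation[where b = "integral {a<..<x + c} (\<lambda>t. deriv u t * (x + c - t) powr - s)" and f = "\<lambda>t. deriv u t * (x + c - t) powr - s" and c = c and a = a and x = "x + c"]
    by (simp add: caputo_deriv_def deriv_translation set_lebesgue_integral_eq_integral(2) algebra_simps)
qed

section \<open>The Beta integral and the Abel kernel\<close>

lemma Beta_kernel_absolutely_integrable:
  fixes s :: real
  assumes "0 < s" "s < 1"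
  shows "(\<lambda>t. t powr (s - 1) * (1 - t) powr (- s)) absolutely_integrable_on {0<..<1}"
    and "integral {0<..<1} (\<lambda>t. t powr (s - 1) * (1 - t) powr (- s)) = Beta s (1 - s)"
proof -
  have "((\<lambda>t. t powr (s - 1) * (1 - t) powr (- s)) has_integral Beta s (1 - s)) {0<..<1}"
    using has_integral_Beta_real[of s "1 - s"] assms by (simp add: has_integral_Icc_iff_Ioo)
  then show "(\<lambda>t. t powr (s - 1) * (1 - t) powr (- s)) absolutely_integrable_on {0<..<1}"
    "integral {0<..<1} (\<lambda>t. t powr (s - 1) * (1 - t) powr (- s)) = Beta s (1 - s)"
    by (auto intro!: nonnegative_absolutely_integrable_1 simp: integral_unique integrable_on_def)
qed

text \<open>The substitution \<open>\<sigma> = t (y + b) / (y (t + b))\<close> reduces the integral to the Beta integral.\<close>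

lemma Abel_kernel:
  fixes s y b :: real
  assumes s: "0 < s" "s < 1" and y: "y > 0" and b: "b > 0"
  defines "K \<equiv> (\<lambda>t. t powr (s - 1) * (y - t) powr (- s) / (t + b))"
  shows "K absolutely_integrable_on {0<..<y}"
    and "integral {0<..<y} K = Beta s (1 - s) * b powr (s - 1) * (y + b) powr (- s)"
proof -
  define g where "g = (\<lambda>t. t * (y + b) / (y * (t + b)))"
  define g' where "g' = (\<lambda>t. (y + b) * b / (y * (t + b)^2))"
  define f where "f = (\<lambda>t. t powr (s - 1) * (1 - t) powr (- s) :: real)"
  \<comment> \<open>The factor independent of \<open>t\<close> that the substitution pulls out:
    Jacobian times Beta integrand is \<open>C * K t\<close>.\<close>
  define C where "C = (y + b) powr s * b powr (1 - s)"
  have C: "C > 0" using y b by (simp add: C_def)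
  have g1: "1 - g t = b * (y - t) / (y * (t + b))" if "t > 0" for t
  proof -
    have "y * (t + b) \<noteq> 0" using y b that by simp
    then have "1 - g t = (y * (t + b) - t * (y + b)) / (y * (t + b))"
      unfolding g_def by (subst diff_divide_distrib) simp
    then show ?thesis by (simp add: algebra_simps)
  qed
  have der: "(g has_field_derivative g' t) (at t within {0<..<y})" if "t \<in> {0<..<y}" for t
  proof -
    have nz: "y * (t + b) \<noteq> 0" using y b that by simp
    have "(g has_field_derivative ((y + b) * (y * (t + b)) - t * (y + b) * y) / (y * (t + b) * (y * (t + b))))
        (at t within {0<..<y})"
      unfolding g_def using nz by (auto intro!: derivative_eq_intros)
    also have "((y + b) * (y * (t + b)) - t * (y + b) * y) / (y * (t + b) * (y * (t + b)))
        = y * ((y + b) * b) / (y * (y * (t + b)^2))"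
      by (simp add: power2_eq_square algebra_simps)
    also have "\<dots> = g' t" unfolding g'_def using y by (rule mult_divide_mult_cancel_left[OF less_imp_neq[symmetric]])
    finally show ?thesis .
  qed
  have inj: "inj_on g {0<..<y}"
  proof (rule inj_onI)
    fix t t' assume t: "t \<in> {0<..<y}" "t' \<in> {0<..<y}" "g t = g t'"
    have pos: "y * (t + b) \<noteq> 0" "y * (t' + b) \<noteq> 0" using t y b by auto
    have "(t * (y + b)) * (y * (t' + b)) = (t' * (y + b)) * (y * (t + b))"
      using t(3) unfolding g_def frac_eq_eq[OF pos] .
    then have "(t - t') * ((y + b) * y * b) = 0" by (simp add: algebra_simps)
    then show "t = t'" using y b by simp
  qed
  have im: "g ` {0<..<y} = {0<..<1}"
  proof (intro equalityI subsetI)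
    fix \<sigma> assume "\<sigma> \<in> g ` {0<..<y}"
    then obtain t where t: "t \<in> {0<..<y}" "\<sigma> = g t" by blast
    then have "1 - g t > 0" using y b by (simp add: g1)
    moreover have "g t > 0" using t y b by (simp add: g_def)
    ultimately show "\<sigma> \<in> {0<..<1}" using t by simp
  next
    fix \<sigma> :: real assume \<sigma>: "\<sigma> \<in> {0<..<1}"
    \<comment> \<open>The solution of \<open>g t = \<sigma>\<close> for \<open>t\<close>.\<close>
    define t where "t = y * b * \<sigma> / (b + y * (1 - \<sigma>))"
    have pos: "b + y * (1 - \<sigma>) > 0" using y b \<sigma> by (simp add: add_pos_pos)
    have "t > 0" using pos y b \<sigma> by (simp add: t_def)
    moreover have "y - t = y * (1 - \<sigma>) * (y + b) / (b + y * (1 - \<sigma>))"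
      using pos by (simp add: t_def field_simps)
    then have "y - t > 0" using pos y b \<sigma> by simp
    moreover have "t + b = b * (y + b) / (b + y * (1 - \<sigma>))"
      using pos by (simp add: t_def field_simps)
    then have "g t = (y * b * \<sigma> / (b + y * (1 - \<sigma>)) * (y + b)) / (y * (b * (y + b) / (b + y * (1 - \<sigma>))))"
      unfolding g_def by (simp add: t_def)
    then have "g t = \<sigma>"
      using pos y b by (simp add: divide_simps)
    ultimately show "\<sigma> \<in> g ` {0<..<y}" by (intro image_eqI[of _ _ t]) auto
  qed
  have eq: "\<bar>g' t\<bar> * f (g t) = C * K t" if t: "t \<in> {0<..<y}" for t
  proof -
    have tb: "t > 0" "y - t > 0" "t + b > 0" "y + b > 0" using t b by auto
    \<comment> \<open>All bases are positive, so the identity between products of powers becomes a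
      linear identity between logarithms.\<close>
    have p: "x powr a = exp (a * ln x)" if "x > 0" for x a :: real using that by (simp add: powr_def)
    have lg: "ln (g t) = ln t + ln (y + b) - ln y - ln (t + b)"
      using tb y b by (simp add: g_def ln_mult ln_div)
    have l1: "ln (1 - g t) = ln b + ln (y - t) - ln y - ln (t + b)"
      using tb y b by (simp add: g1 ln_mult ln_div)
    have pos: "g t > 0" "1 - g t > 0" using tb y b by (simp_all add: g1) (simp add: g_def)
    have "\<bar>g' t\<bar> = exp (ln (y + b) + ln b - ln y - (ln (t + b) + ln (t + b)))"
      unfolding g'_def exp_diff exp_add power2_eq_square using tb y b by simp
    moreover have "f (g t) = exp ((s - 1) * ln (g t) + - s * ln (1 - g t))"
      unfolding f_def using pos by (simp only: p exp_add)
    ultimately have "\<bar>g' t\<bar> * f (g t) = exp ((s - 1) * ln t - s * ln (y - t) + s * ln (y + b) + (1 - s) * ln b - ln (t + b))"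
      unfolding lg l1 by (simp flip: exp_add) (simp add: algebra_simps)
    also have "\<dots> = C * K t"
    proof -
      have "C * K t = exp (s * ln (y + b)) * exp ((1 - s) * ln b) *
          (exp ((s - 1) * ln t) * exp (- s * ln (y - t)) * exp (- ln (t + b)))"
        unfolding C_def K_def divide_inverse using tb b by (simp only: p exp_minus exp_ln)
      also have "\<dots> = exp ((s - 1) * ln t - s * ln (y - t) + s * ln (y + b) + (1 - s) * ln b - ln (t + b))"
        unfolding exp_add[symmetric] by (rule arg_cong[of _ _ exp]) simp
      finally show ?thesis by simp
    qed
    finally show ?thesis .
  qed
  have "(\<lambda>t. \<bar>g' t\<bar> * f (g t)) absolutely_integrable_on {0<..<y} \<and>
      integral {0<..<y} (\<lambda>t. \<bar>g' t\<bar> * f (g t)) = Beta s (1 - s)"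
    using has_absolute_integral_change_of_variables_1'[of "{0<..<y}" g g' f "Beta s (1 - s)"] der inj
      Beta_kernel_absolutely_integrable[OF s] unfolding im f_def by auto
  moreover have "integral {0<..<y} (\<lambda>t. \<bar>g' t\<bar> * f (g t)) = integral {0<..<y} (\<lambda>t. C * K t)"
    by (rule integral_cong) (rule eq)
  ultimately have *: "(\<lambda>t. C * K t) absolutely_integrable_on {0<..<y}" "integral {0<..<y} (\<lambda>t. C * K t) = Beta s (1 - s)"
    using eq by (auto intro: absolutely_integrable_spike[of _ _ "{}"])
  have "(\<lambda>t. inverse C * (C * K t)) absolutely_integrable_on {0<..<y}"
    using *(1) by (rule set_integrable_mult_right)
  then show "K absolutely_integrable_on {0<..<y}" using C by simp
  have "C * integral {0<..<y} K = Beta s (1 - s)" using *(2) by simp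
  then have "integral {0<..<y} K = Beta s (1 - s) * inverse C" using C by (simp add: field_simps)
  also have "inverse C = b powr (s - 1) * (y + b) powr (- s)"
    using y b by (simp add: C_def powr_minus powr_diff field_simps)
  finally show "integral {0<..<y} K = Beta s (1 - s) * b powr (s - 1) * (y + b) powr (- s)" by simp
qed

section \<open>Solution of the Abel equation\<close>

locale abel_weight =
  fixes s d :: real and w :: "real \<Rightarrow> real"
  assumes s: "0 < s" "s < 1"
    and d: "d \<ge> 1"
    and w_continuous: "continuous_on UNIV w"
    and w_zero: "b \<notin> {1..d} \<Longrightarrow> w b = 0"
begin

text \<open>
  Abel's integral equation: the derivative is prescribed as
  \<open>- B b\<^sup>s\<^sup>-\<^sup>1 w(b)\<close> at \<open>- b\<close>, where \<open>B = Beta s (1 - s)\<close>, and \<open>v\<close> is for positive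
  arguments the continuation annihilated by the Caputo derivative.
\<close>

definition H :: "real \<Rightarrow> real" where
  "H t = integral {1..d} (\<lambda>b. w b / (t + b))"

text \<open>Lies to the left of \<open>[- d, - 1]\<close>, the reflected support interval of
  \<open>w\<close>, so the integral from \<open>a\<close> sees the whole prescribed
  derivative.\<close>

definition a :: real where "a = - (d + 1)"

definition v :: "real \<Rightarrow> real" where
  "v t = (if t > 0 then t powr (s - 1) * H t else - Beta s (1 - s) * ((- t) powr (s - 1) * w (- t)))"

text \<open>The constant \<open>c\<close> is left free to match a value later. For
  \<open>x < a\<close> the interval is empty, which gives the conventional constant
  extension.\<close>

definition u :: "real \<Rightarrow> real \<Rightarrow> real" where
  "u c x = c + integral {a..x} v"

lemma a_less: "a < -1"
  using d by (simp add: a_def)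

lemma continuous_on_w: "continuous_on A w"
  using w_continuous continuous_on_subset by blast

lemma H_continuous: "continuous_on {0..} H"
proof -
  have "continuous_on {0..} (\<lambda>t. integral (cbox 1 d) (\<lambda>b. w b / (t + b)))"
  proof (rule integral_continuous_on_param)
    have "continuous_on A (\<lambda>x. w (snd x))" for A :: "(real \<times> real) set"
      by (rule continuous_on_compose2[OF w_continuous]) (auto intro!: continuous_intros)
    then show "continuous_on ({0..} \<times> cbox 1 d) (\<lambda>(t, b). w b / (t + b))"
      by (auto simp: split_beta intro!: continuous_intros)
  qed
  then show ?thesis unfolding H_def[abs_def] by simp
qed

text \<open>The singularity of \<open>(- t) powr (s - 1)\<close> at 0 is never met: on
  \<open>[-1/2, 0]\<close> the weight vanishes, and the two pieces are glued at -1/2.\<close>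

lemma v_continuous_nonpos: "continuous_on {..0} v"
proof -
  have "continuous_on {..-1/2} (\<lambda>t. - Beta s (1 - s) * ((- t) powr (s - 1) * w (- t)))"
    by (intro continuous_intros continuous_on_compose2[OF w_continuous]) auto
  then have 1: "continuous_on {..-1/2} v"
    by (rule continuous_on_eq) (auto simp: v_def)
  have 2: "continuous_on {-1/2..0} v"
    by (rule continuous_on_eq[OF continuous_on_const[of _ 0]]) (auto simp: v_def w_zero)
  have "{..-1/2} \<union> {-1/2..0} = {..0::real}" by auto
  then show ?thesis using continuous_on_closed_Un[OF _ _ 1 2] by simp
qed

lemma v_continuous_pos: "continuous_on {0<..} v"
proof -
  have "continuous_on {0<..} (\<lambda>t. t powr (s - 1) * H t)"
    by (intro continuous_intros continuous_on_subset[OF H_continuous]) auto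
  then show ?thesis by (rule continuous_on_eq) (auto simp: v_def)
qed

lemma isCont_v:
  assumes "t \<noteq> 0"
  shows "isCont v t"
proof (cases "t > 0")
  case True
  then show ?thesis
    using v_continuous_pos by (simp add: continuous_on_eq_continuous_at)
next
  case False
  have "continuous_on {..<0} v" by (rule continuous_on_subset[OF v_continuous_nonpos]) auto
  then show ?thesis using False assms by (simp add: continuous_on_eq_continuous_at)
qed

text \<open>The only singularity is that of \<open>t powr (s - 1)\<close> at 0 from the right,
  integrable because \<open>s > 0\<close>.\<close>

lemma v_absolutely_integrable: "v absolutely_integrable_on {a..x}"
proof -
  have neg: "v absolutely_integrable_on {a..y}" if "y \<le> 0" for y
    using that by (intro absolutely_integrable_continuous_real continuous_on_subset[OF v_continuous_nonpos]) auto
  show ?thesis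
  proof (cases "x \<le> 0")
    case False
    have "(\<lambda>t. t powr (s - 1)) absolutely_integrable_on {0..x}"
      using has_integral_powr_from_0[of "s - 1" x] s False
      by (intro nonnegative_absolutely_integrable_1) (auto simp: integrable_on_def)
    then have "(\<lambda>t. H t * t powr (s - 1)) absolutely_integrable_on {0..x}"
      by (rule absolutely_integrable_continuous_mult[of _ _ 0 x])
         (auto intro: continuous_on_subset[OF H_continuous])
    then have "v absolutely_integrable_on {0..x}"
      by (rule absolutely_integrable_spike[of _ _ "{0}"]) (auto simp: v_def)
    then have "v absolutely_integrable_on ({a..0} \<union> {0..x})"
      by (rule absolutely_integrable_Un[OF neg[OF order_refl]])
    also have "{a..0} \<union> {0..x} = {a..x}" using False a_less by auto
    finally show ?thesis .
  qed (rule neg)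
qed

lemma u_has_derivative:
  assumes "a < t" "t \<noteq> 0"
  shows "(u c has_real_derivative v t) (at t)"
proof -
  have "((\<lambda>x. integral {a..x} v) has_vector_derivative v t) (at t within ({a..t+1} - {}))"
  proof (rule integral_has_vector_derivative_continuous_at)
    show "v integrable_on {a..t+1}"
      by (rule set_lebesgue_integral_eq_integral(1)[OF v_absolutely_integrable])
    show "continuous (at t within {a..t+1} - {}) v"
      by (rule continuous_at_imp_continuous_at_within[OF isCont_v[OF assms(2)]])
  qed (use assms in auto)
  moreover have "at t within ({a..t+1} - {}) = at t"
    using assms by (intro at_within_interior) auto
  ultimately show ?thesis
    unfolding u_def[abs_def]
    by (auto simp: has_real_derivative_iff_has_vector_derivative intro!: derivative_eq_intros)
qed

lemma u_initial: "t < a \<Longrightarrow> u c t = u c a"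
  by (simp add: u_def)

section \<open>Integrability of the Caputo integrand\<close>

definition \<phi> :: "real \<Rightarrow> real \<Rightarrow> real" where
  "\<phi> x t = t powr (s - 1) * (x - t) powr (- s)"

lemma \<phi>_absolutely_integrable: "x > 0 \<Longrightarrow> \<phi> x absolutely_integrable_on {0<..<x}"
proof -
  assume "x > 0"
  \<comment> \<open>\<open>Abel_kernel\<close> with \<open>b = 1\<close> is used; its extra factor
    \<open>1 / (t + 1)\<close> is cancelled by the continuous factor \<open>t + 1\<close>.\<close>
  then have "(\<lambda>t. (t + 1) * (t powr (s - 1) * (x - t) powr (- s) / (t + 1))) absolutely_integrable_on {0<..<x}"
    using Abel_kernel(1)[OF s, of x 1]
    by (intro absolutely_integrable_continuous_mult[of _ _ 0 x]) (auto intro!: continuous_intros)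
  then show ?thesis
    by (rule absolutely_integrable_spike[of _ _ "{}"]) (auto simp: \<phi>_def)
qed

text \<open>The reflection of \<open>t\<close> to \<open>x - t\<close> moves the singularity to 0,
  where \<open>t powr (- s)\<close> is integrable because \<open>s < 1\<close>.\<close>

lemma powr_kernel_absolutely_integrable:
  "(\<lambda>t. (x - t) powr (- s)) absolutely_integrable_on {p<..<x}"
proof (cases "p < x")
  case True
  have im: "(\<lambda>t. x - t) ` {p<..<x} = {0<..<x - p}"
    by (force simp: image_iff intro: bexI[of _ "x - _"])
  have "((\<lambda>t. t powr (- s)) has_integral (x - p) powr (- s + 1) / (- s + 1)) {0<..<x - p}"
    using has_integral_powr_from_0[of "- s" "x - p"] s True by (simp add: has_integral_Icc_iff_Ioo)
  then have "(\<lambda>t. t powr (- s)) absolutely_integrable_on {0<..<x - p}"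
    by (intro nonnegative_absolutely_integrable_1) (auto simp: integrable_on_def)
  moreover have "((\<lambda>t. x - t) has_field_derivative - 1) (at t within {p<..<x})" for t
    by (auto intro!: derivative_eq_intros)
  moreover have "inj_on (\<lambda>t. x - t) {p<..<x}" by (auto simp: inj_on_def)
  ultimately show ?thesis
    using has_absolute_integral_change_of_variables_1'[of "{p<..<x}" "\<lambda>t. x - t" "\<lambda>_. - 1"
        "\<lambda>t. t powr (- s)" "integral {0<..<x - p} (\<lambda>t. t powr (- s))"]
    unfolding im by simp
qed (simp add: greaterThanLessThan_empty)

text \<open>\<open>C1s\<close> demands integrability for every \<open>x > a\<close>, hence also to
  the left of 0; there \<open>v\<close> is continuous and only the kernel is singular.\<close>

lemma integrand_nonpos: "x \<le> 0 \<Longrightarrow> (\<lambda>t. v t * (x - t) powr (- s)) absolutely_integrable_on {a<..<x}"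
  using powr_kernel_absolutely_integrable
  by (rule absolutely_integrable_continuous_mult[of _ _ a x])
     (auto intro: continuous_on_subset[OF v_continuous_nonpos])

lemma integrand_left: "x > 0 \<Longrightarrow> (\<lambda>t. v t * (x - t) powr (- s)) absolutely_integrable_on {a..0}"
  by (intro absolutely_integrable_continuous_real continuous_intros continuous_on_subset[OF v_continuous_nonpos]) auto

lemma integrand_right:
  assumes "x > 0"
  shows "(\<lambda>t. v t * (x - t) powr (- s)) absolutely_integrable_on {0<..<x}"
proof -
  have "(\<lambda>t. H t * \<phi> x t) absolutely_integrable_on {0<..<x}"
    using \<phi>_absolutely_integrable[OF assms]
    by (rule absolutely_integrable_continuous_mult[of _ _ 0 x])
       (auto intro: continuous_on_subset[OF H_continuous])
  then show ?thesis
    by (rule absolutely_integrable_spike[of _ _ "{}"]) (auto simp: v_def \<phi>_def)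
qed

lemma integrand_absolutely_integrable:
  "(\<lambda>t. v t * (x - t) powr (- s)) absolutely_integrable_on {a<..<x}"
proof (cases "x > 0")
  case True
  have "(\<lambda>t. v t * (x - t) powr (- s)) absolutely_integrable_on ({a..0} \<union> {0<..<x})"
    by (intro absolutely_integrable_Un integrand_left integrand_right True)
  then show ?thesis by (rule set_integrable_subset) auto
qed (simp add: integrand_nonpos)

text \<open>Substituting \<open>b = - t\<close> turns \<open>x - t\<close> into
  \<open>x + b\<close>; the support of \<open>w\<close> then cuts the range down to
  \<open>{1..d}\<close>.\<close>

lemma integral_left:
  assumes "x > 0"
  shows "integral {a..0} (\<lambda>t. v t * (x - t) powr (- s))
    = - Beta s (1 - s) * integral {1..d} (\<lambda>b. w b * (b powr (s - 1) * (x + b) powr (- s)))"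
proof -
  let ?g = "\<lambda>b. w b * (b powr (s - 1) * (x + b) powr (- s))"
  have "integral {a..0} (\<lambda>t. v t * (x - t) powr (- s)) = integral {a..0} (\<lambda>t. - Beta s (1 - s) * ?g (- t))"
    by (rule integral_cong) (simp add: v_def)
  also have "\<dots> = integral {- (d + 1)..- 0} (\<lambda>t. - Beta s (1 - s) * ?g (- t))"
    by (simp add: a_def)
  also have "integral {- (d + 1)..- 0} (\<lambda>t. - Beta s (1 - s) * ?g (- t)) = - Beta s (1 - s) * integral {- (d + 1)..- 0} (\<lambda>t. ?g (- t))"
    by (rule integral_mult_right)
  also have "integral {- (d + 1)..- 0} (\<lambda>t. ?g (- t)) = integral {0..d + 1} ?g"
    by (rule Henstock_Kurzweil_Integration.integral_reflect_real)
  also have "\<dots> = integral {1..d} ?g"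
  proof -
    have "integral {0..d + 1} ?g = integral {0..d + 1} (\<lambda>b. if b \<in> {1..d} then ?g b else 0)"
      by (rule integral_cong) (use w_zero in auto)
    also have "\<dots> = integral {1..d} ?g"
      using Henstock_Kurzweil_Integration.integral_restrict_Int[of "{0..d + 1}" "{1..d}" ?g]
      by (simp add: Int_absorb1)
    finally show ?thesis .
  qed
  finally show ?thesis .
qed

text \<open>Inserting the integral for \<open>H\<close> and exchanging the order of integration
  leaves for each \<open>b\<close> the inner integral evaluated by
  \<open>Abel_kernel\<close>.\<close>

lemma integral_right:
  assumes "x > 0"
  shows "integral {0<..<x} (\<lambda>t. v t * (x - t) powr (- s))
    = Beta s (1 - s) * integral {1..d} (\<lambda>b. w b * (b powr (s - 1) * (x + b) powr (- s)))"
proof -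
  \<comment> \<open>Indicators extend the integrand to the whole plane, so that Fubini applies to
    the product of two copies of \<open>lborel\<close>.\<close>
  define F where "F = (\<lambda>t b. (indicat_real {0<..<x} t * \<phi> x t) * (indicat_real {1..d} b * (w b / (t + b))))"
  define \<psi> where "\<psi> = (\<lambda>b. indicat_real {1..d} b * \<bar>w b\<bar>)"
  have w_meas [measurable]: "w \<in> borel_measurable borel"
    by (rule borel_measurable_continuous_onI[OF w_continuous])
  have \<phi>_meas [measurable]: "\<phi> x \<in> borel_measurable borel"
    unfolding \<phi>_def[abs_def] by measurable
  have \<phi>_int: "integrable lborel (\<lambda>t. indicat_real {0<..<x} t * \<phi> x t)"
    using \<phi>_absolutely_integrable[OF assms] unfolding set_integrable_def
    by (subst (asm) integrable_completion) auto
  have \<psi>_int: "integrable lborel \<psi>"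
    using borel_integrable_compact[of "{1..d}" "\<lambda>b. \<bar>w b\<bar>"] continuous_on_w
    unfolding \<psi>_def set_integrable_def by (auto intro: continuous_intros)
  have \<phi>0: "\<phi> x t \<ge> 0" for t by (simp add: \<phi>_def)
  \<comment> \<open>Since \<open>1 / (t + b) \<le> 1\<close> for \<open>t > 0\<close> and
    \<open>b \<ge> 1\<close>, a product of two integrable functions of one variable dominates
    \<open>F\<close>.\<close>
  have F_bound: "norm (F t b) \<le> norm (indicat_real {0<..<x} t * \<phi> x t * \<psi> b)" for t b
  proof (cases "t \<in> {0<..<x} \<and> b \<in> {1..d}")
    case True
    then have "\<bar>w b\<bar> / (t + b) \<le> \<bar>w b\<bar> / 1" by (intro divide_left_mono) auto
    then have "\<phi> x t * (\<bar>w b\<bar> / (t + b)) \<le> \<phi> x t * \<bar>w b\<bar>" using \<phi>0 by (intro mult_left_mono) auto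
    then show ?thesis using True \<phi>0[of t] by (simp add: F_def \<psi>_def abs_mult)
  qed (auto simp: F_def)
  have F_meas [measurable]: "case_prod F \<in> borel_measurable (lborel \<Otimes>\<^sub>M lborel)"
    unfolding F_def by measurable
  have Ft_int: "integrable lborel (F t)" for t
    by (rule Bochner_Integration.integrable_bound[where f = "\<lambda>b. indicat_real {0<..<x} t * \<phi> x t * \<psi> b"])
       (use F_bound \<psi>_int in \<open>auto simp: F_def\<close>)
  have F_int: "integrable (lborel \<Otimes>\<^sub>M lborel) (case_prod F)"
  proof (rule lborel_pair.Fubini_integrable[OF F_meas])
    show "integrable lborel (\<lambda>t. \<integral>b. norm (case_prod F (t, b)) \<partial>lborel)"
    proof (rule Bochner_Integration.integrable_bound[where f = "\<lambda>t. indicat_real {0<..<x} t * \<phi> x t * integral\<^sup>L lborel \<psi>"])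
      show "integrable lborel (\<lambda>t. indicat_real {0<..<x} t * \<phi> x t * integral\<^sup>L lborel \<psi>)"
        using \<phi>_int by simp
      show "AE t in lborel. norm (\<integral>b. norm (case_prod F (t, b)) \<partial>lborel) \<le> norm (indicat_real {0<..<x} t * \<phi> x t * integral\<^sup>L lborel \<psi>)"
      proof (rule AE_I2)
        fix t
        have "(\<integral>b. norm (F t b) \<partial>lborel) \<le> (\<integral>b. indicat_real {0<..<x} t * \<phi> x t * \<psi> b \<partial>lborel)"
          using F_bound[of t] \<phi>0[of t] Ft_int[of t] \<psi>_int
          by (intro integral_mono) (auto simp: abs_mult \<psi>_def)
        then show "norm (\<integral>b. norm (case_prod F (t, b)) \<partial>lborel) \<le> norm (indicat_real {0<..<x} t * \<phi> x t * integral\<^sup>L lborel \<psi>)"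
          by simp
      qed
    qed measurable
    show "AE t in lborel. integrable lborel (\<lambda>b. case_prod F (t, b))"
      using Ft_int by simp
  qed
  have "integral {0<..<x} (\<lambda>t. v t * (x - t) powr (- s)) = (LINT t:{0<..<x}|lebesgue. \<phi> x t * H t)"
  proof -
    have eq: "v t * (x - t) powr (- s) = \<phi> x t * H t" if "t \<in> {0<..<x}" for t
      using that by (simp add: v_def \<phi>_def)
    have "integral {0<..<x} (\<lambda>t. v t * (x - t) powr (- s)) = (LINT t:{0<..<x}|lebesgue. v t * (x - t) powr (- s))"
      by (rule set_lebesgue_integral_eq_integral(2)[OF integrand_right[OF assms], symmetric])
    also have "\<dots> = (LINT t:{0<..<x}|lebesgue. \<phi> x t * H t)"
      by (rule set_lebesgue_integral_cong) (auto simp: eq)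
    finally show ?thesis .
  qed
  also have "\<dots> = (LINT t|lebesgue. (LINT b|lborel. F t b))"
    unfolding set_lebesgue_integral_def
  proof (rule Bochner_Integration.integral_cong)
    fix t
    show "indicat_real {0<..<x} t *\<^sub>R (\<phi> x t * H t) = (LINT b|lborel. F t b)"
    proof (cases "t \<in> {0<..<x}")
      case True
      then have "continuous_on {1..d} (\<lambda>b. w b / (t + b))"
        by (auto intro!: continuous_intros continuous_on_w)
      then have "set_integrable lborel {1..d} (\<lambda>b. w b / (t + b))"
        unfolding set_integrable_def using borel_integrable_compact[of "{1..d}" "\<lambda>b. w b / (t + b)"] by simp
      then have "H t = (LINT b:{1..d}|lborel. w b / (t + b))"
        unfolding H_def by (rule set_borel_integral_eq_integral(2)[symmetric])
      moreover have "F t = (\<lambda>b. \<phi> x t * (indicat_real {1..d} b *\<^sub>R (w b / (t + b))))"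
        using True by (simp add: F_def fun_eq_iff)
      ultimately show ?thesis
        using True by (simp only: set_lebesgue_integral_def integral_mult_right_zero) simp
    qed (simp add: F_def)
  qed simp
  \<comment> \<open>The Caputo integral is taken over \<open>lebesgue\<close>, Fubini over
    \<open>lborel\<close>; completion does not change the integral of a Borel function.\<close>
  also have "\<dots> = (LINT t|lborel. (LINT b|lborel. F t b))"
    by (rule integral_completion) measurable
  also have "\<dots> = (LINT b|lborel. (LINT t|lborel. F t b))"
    by (rule lborel_pair.Fubini_integral[OF F_int, symmetric])
  also have "\<dots> = (LINT b|lborel. Beta s (1 - s) * (indicat_real {1..d} b *\<^sub>R (w b * (b powr (s - 1) * (x + b) powr (- s)))))"
  proof (rule Bochner_Integration.integral_cong)
    fix b
    show "(LINT t|lborel. F t b) = Beta s (1 - s) * (indicat_real {1..d} b *\<^sub>R (w b * (b powr (s - 1) * (x + b) powr (- s))))"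
    proof (cases "b \<in> {1..d}")
      case True
      then have b: "b > 0" by simp
      have "(LINT t|lborel. F t b) = (LINT t|lebesgue. F t b)"
        by (rule integral_completion[symmetric]) (simp add: F_def)
      also have "\<dots> = (LINT t|lebesgue. w b * (indicat_real {0<..<x} t *\<^sub>R (t powr (s - 1) * (x - t) powr (- s) / (t + b))))"
        using True by (intro Bochner_Integration.integral_cong) (auto simp: F_def \<phi>_def)
      also have "\<dots> = w b * (LINT t:{0<..<x}|lebesgue. t powr (s - 1) * (x - t) powr (- s) / (t + b))"
        unfolding set_lebesgue_integral_def by (rule integral_mult_right_zero)
      also have "(LINT t:{0<..<x}|lebesgue. t powr (s - 1) * (x - t) powr (- s) / (t + b))
          = Beta s (1 - s) * b powr (s - 1) * (x + b) powr (- s)"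
        using set_lebesgue_integral_eq_integral(2)[OF Abel_kernel(1)[OF s assms b]] Abel_kernel(2)[OF s assms b] by simp
      finally show ?thesis using True by simp
    qed (simp add: F_def)
  qed simp
  also have "\<dots> = Beta s (1 - s) * (LINT b:{1..d}|lborel. w b * (b powr (s - 1) * (x + b) powr (- s)))"
    unfolding set_lebesgue_integral_def by (rule integral_mult_right_zero)
  also have "(LINT b:{1..d}|lborel. w b * (b powr (s - 1) * (x + b) powr (- s)))
      = integral {1..d} (\<lambda>b. w b * (b powr (s - 1) * (x + b) powr (- s)))"
  proof (rule set_borel_integral_eq_integral(2))
    have "continuous_on {1..d} (\<lambda>b. w b * (b powr (s - 1) * (x + b) powr (- s)))"
      using assms by (auto intro!: continuous_intros continuous_on_w)
    then show "set_integrable lborel {1..d} (\<lambda>b. w b * (b powr (s - 1) * (x + b) powr (- s)))"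
      unfolding set_integrable_def
      using borel_integrable_compact[of "{1..d}" "\<lambda>b. w b * (b powr (s - 1) * (x + b) powr (- s))"] by simp
  qed
  finally show ?thesis .
qed

text \<open>Split at 0: the factor \<open>- Beta s (1 - s)\<close> in \<open>v\<close> makes the two
  halves opposite multiples of the same integral over \<open>{1..d}\<close>.\<close>

lemma integral_integrand:
  assumes "x > 0"
  shows "integral {a<..<x} (\<lambda>t. v t * (x - t) powr (- s)) = 0"
proof -
  let ?g = "\<lambda>t. v t * (x - t) powr (- s)"
  have "integral {a<..<x} ?g = integral {a..x} ?g"
    by (simp add: integral_open_interval_real)
  also have "\<dots> = integral {a..0} ?g + integral {0..x} ?g"
  proof (rule Henstock_Kurzweil_Integration.integral_combine[symmetric])
    show "?g integrable_on {a..x}"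
      using set_lebesgue_integral_eq_integral(1)[OF integrand_absolutely_integrable[of x]]
      by (simp add: integrable_on_Icc_iff_Ioo)
  qed (use assms a_less in auto)
  also have "integral {0..x} ?g = integral {0<..<x} ?g"
    by (simp add: integral_open_interval_real)
  finally show ?thesis
    using integral_left[OF assms] integral_right[OF assms] by simp
qed

text \<open>\<open>deriv (u c)\<close> and \<open>v\<close> agree on the interval except possibly at
  0, a negligible set.\<close>

lemma deriv_u_integrand:
  shows "(\<lambda>t. deriv (u c) t * (x - t) powr (- s)) absolutely_integrable_on {a<..<x}"
    and "integral {a<..<x} (\<lambda>t. deriv (u c) t * (x - t) powr (- s)) = integral {a<..<x} (\<lambda>t. v t * (x - t) powr (- s))"
proof -
  have eq: "deriv (u c) t * (x - t) powr (- s) = v t * (x - t) powr (- s)" if "t \<in> {a<..<x} - {0}" for t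
    using u_has_derivative[of t c] that by (simp add: DERIV_imp_deriv)
  show "(\<lambda>t. deriv (u c) t * (x - t) powr (- s)) absolutely_integrable_on {a<..<x}"
    by (rule absolutely_integrable_spike[OF integrand_absolutely_integrable negligible_sing eq])
  show "integral {a<..<x} (\<lambda>t. deriv (u c) t * (x - t) powr (- s)) = integral {a<..<x} (\<lambda>t. v t * (x - t) powr (- s))"
    by (rule integral_spike[of "{0}", OF _ eq[symmetric]]) simp_all
qed

lemma u_in_C1s: "u c \<in> C1s a s"
proof -
  have "abs_continuous_on_interval a x (u c)" for x
    using abs_continuous_integral[OF v_absolutely_integrable] by (simp add: u_def[abs_def])
  then show ?thesis
    using deriv_u_integrand(1) by (simp add: C1s_def)
qed

lemma caputo_deriv_u: "x > 0 \<Longrightarrow> caputo_deriv a s (u c) x = 0"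
  unfolding caputo_deriv_def
  by (simp add: set_lebesgue_integral_eq_integral(2)[OF deriv_u_integrand(1)] deriv_u_integrand(2) integral_integrand)

end

section \<open>Density of Caputo-stationary functions\<close>

theorem theorem0p3:
  fixes k :: nat and s :: real and f :: "real \<Rightarrow> real" and \<epsilon> :: real
  assumes "0 < s" and "s < 1"
    and "f \<in> Ck_on k {0..1}"
    and "\<epsilon> > 0"
  shows "\<exists>a<0. \<exists>u. u \<in> C1s a s \<and>
           (\<forall>t<a. u t = u a) \<and>
           (\<forall>x\<in>{0..}. caputo_deriv a s u x = 0) \<and>
           u \<in> Ck_on k {0..1} \<and>
           Ck_norm k {0..1} (\<lambda>x. u x - f x) < \<epsilon>"
proof -
  \<comment> \<open>Each order of differentiation costs \<open>e\<close> between \<open>u'\<close>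
    and the polynomial and \<open>e\<close> between the polynomial and \<open>f\<close>, in total
    two thirds of \<epsilon>.\<close>
  define e where "e = \<epsilon> / (3 * real (Suc k))"
  have e: "e > 0" using \<open>\<epsilon> > 0\<close> by (simp add: e_def)
  define F where "F = (\<lambda>i. nth_deriv_on {0..1} i f)"
  have F: "deriv_seq k F"
    unfolding F_def by (rule Ck_on_imp_deriv_seq[OF assms(3)])
  obtain p where p: "\<And>i x. i \<le> k \<Longrightarrow> x \<in> {0..1} \<Longrightarrow> \<bar>F i x - poly ((pderiv ^^ i) p) x\<bar> < e"
    using deriv_seq_poly_approx[OF F e] by blast
  \<comment> \<open>The transform describes the derivative of the solution, so the target is
    \<open>pderiv p\<close> rather than \<open>p\<close>.\<close>
  obtain w where w: "weight w" and approx: "\<And>i x. i \<le> k \<Longrightarrow> x \<in> {0..1} \<Longrightarrow>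
      \<bar>Re ((deriv ^^ i) (\<lambda>z. z powr of_real (s - 1) * stieltjes w z) (of_real (x + 2)))
        - poly ((pderiv ^^ i) (pderiv p)) x\<bar> < e"
    using stieltjes_powr_approx_poly[OF e \<open>s < 1\<close>, of k "pderiv p"] by blast
  define V where "V = (\<lambda>z. z powr of_real (s - 1) * stieltjes w z)"
  obtain d where d: "d \<ge> 1" and w_zero': "\<And>b. b \<notin> {1..d} \<Longrightarrow> w b = 0"
    using w unfolding weight_def by blast
  interpret abel_weight s d "\<lambda>b. Re (w b)"
    using assms(1,2) d w_zero' w by unfold_locales (auto simp: weight_def intro!: continuous_intros)
  \<comment> \<open>For real \<open>y\<close> the denominators are real, so taking real parts
    replaces the weight \<open>w\<close> by \<open>Re (w b)\<close>, the weight of the interpreted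
    locale.\<close>
  have v_eq: "v y = Re (V (of_real y))" if "y > 0" for y
  proof -
    have "(\<lambda>b. w b / (of_real y + of_real b)) integrable_on {1..d}"
      using integrable_on_subcbox[OF stieltjes_integrable[OF w, of "of_real y"], of 1 d] that by simp
    then have "Re (stieltjes w (of_real y)) = integral {1..d} (Re \<circ> (\<lambda>b. w b / (of_real y + of_real b)))"
      using stieltjes_integral_eq[of d w] w_zero' by (simp add: integral_linear[OF _ bounded_linear_Re])
    also have "\<dots> = H y"
      unfolding H_def by (intro integral_cong) (simp add: Re_divide_of_real flip: of_real_add)
    finally show ?thesis
      using that by (simp add: v_def V_def powr_of_real flip: of_real_diff)
  qed
  \<comment> \<open>Chosen so that the translated solution takes the value \<open>poly p 0\<close>
    at 0.\<close>
  define c where "c = poly p 0 - integral {a..2} v"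
  \<comment> \<open>The translate carrying \<open>[2, 3]\<close> to \<open>[0, 1]\<close>, not a
    derivative.\<close>
  define u' where "u' = (\<lambda>x. u c (x + 2))"
  \<comment> \<open>The index shifts by one: order \<open>Suc j\<close> of the solution is order
    \<open>j\<close> of \<open>V\<close>.\<close>
  define G where "G = (\<lambda>i x. case i of 0 \<Rightarrow> u' x | Suc j \<Rightarrow> Re ((deriv ^^ j) V (of_real (x + 2))))"
  have Vseq: "deriv_seq k (\<lambda>i x. Re ((deriv ^^ i) V (of_real (x + 2))))" for k
    unfolding V_def
    by (rule deriv_seq_Re[OF stieltjes_powr_holomorphic[OF w] open_halfspace_Re_gt]) auto
  have G0: "(u' has_vector_derivative G 1 x) (at x within {0..1})" if "x \<in> {0..1}" for x
  proof -
    have "(u c has_real_derivative v (x + 2)) (at (x + 2))"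
      using that a_less by (intro u_has_derivative) auto
    then have "(u' has_real_derivative v (x + 2)) (at x)"
      unfolding u'_def by (simp add: DERIV_shift)
    moreover have "v (x + 2) = G 1 x" using that v_eq[of "x + 2"] by (simp add: G_def)
    ultimately show ?thesis
      by (auto simp: has_real_derivative_iff_has_vector_derivative intro: has_vector_derivative_at_within)
  qed
  have G: "deriv_seq k G"
  proof (cases k)
    case 0
    have "continuous_on {0..1} u'"
      using G0 has_vector_derivative_continuous continuous_on_eq_continuous_within by metis
    then show ?thesis by (simp add: 0 deriv_seq_def G_def)
  next
    case (Suc j)
    have "(G i has_vector_derivative G (Suc i) x) (at x within {0..1})" if "i < k" "x \<in> {0..1}" for i x
    proof (cases i)
      case 0
      then show ?thesis using G0[OF that(2)] by (simp add: G_def)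
    next
      case (Suc n)
      then show ?thesis using deriv_seqD[OF Vseq, of n "Suc n" x] that by (simp add: G_def)
    qed
    moreover have "continuous_on {0..1} (G k)"
      using deriv_seq_continuous[OF Vseq[of j] order_refl] by (simp add: G_def Suc)
    ultimately show ?thesis by (simp add: deriv_seq_def)
  qed
  have GP: "\<bar>G i x - poly ((pderiv ^^ i) p) x\<bar> \<le> e" if i: "i \<le> k" and x: "x \<in> {0..1}" for i x
  proof (cases i)
    case 0
    \<comment> \<open>The error at order 0 vanishes at 0 by the choice of \<open>c\<close>; the mean
      value inequality on an interval of length 1 bounds it by the error at order 1.\<close>
    have "norm ((u' x - poly p x) - (u' 0 - poly p 0)) \<le> e * norm (x - 0)"
    proof (rule differentiable_bound[of "{0..1}"])
      fix y :: real assume y: "y \<in> {0..1}"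
      have "(poly p has_vector_derivative poly (pderiv p) y) (at y within {0..1})"
        using poly_DERIV[of p y]
        by (auto simp: has_real_derivative_iff_has_vector_derivative intro: has_vector_derivative_at_within)
      then show "((\<lambda>x. u' x - poly p x) has_derivative (\<lambda>h. h *\<^sub>R (G 1 y - poly (pderiv p) y))) (at y within {0..1})"
        using has_vector_derivative_diff[OF G0[OF y]] by (simp add: has_vector_derivative_def)
      show "onorm (\<lambda>h. h *\<^sub>R (G 1 y - poly (pderiv p) y)) \<le> e"
      proof (rule onorm_le)
        fix h :: real
        have "\<bar>G 1 y - poly (pderiv p) y\<bar> \<le> e" using approx[of 0 y] y by (simp add: G_def V_def)
        then have "\<bar>h\<bar> * \<bar>G 1 y - poly (pderiv p) y\<bar> \<le> \<bar>h\<bar> * e" by (rule mult_left_mono) simp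
        then show "norm (h *\<^sub>R (G 1 y - poly (pderiv p) y)) \<le> e * norm h"
          by (simp add: abs_mult mult.commute)
      qed
    qed (use x in auto)
    also have "e * norm (x - 0) \<le> e * 1" using x e by (intro mult_left_mono) auto
    finally show ?thesis using 0 by (simp add: G_def u'_def u_def c_def)
  next
    case (Suc j)
    then show ?thesis using approx[of j x] i x by (simp add: G_def V_def funpow_swap1)
  qed
  have "Ck_norm k {0..1} (\<lambda>x. u' x - f x) \<le> real (Suc k) * (2 * e)"
  proof (rule Ck_norm_le[OF deriv_seq_diff[OF G F]])
    show "\<bar>G i x - F i x\<bar> \<le> 2 * e" if "i \<le> k" "x \<in> {0..1}" for i x
      using GP[OF that] p[OF that] by linarith
  qed (simp add: G_def F_def)
  also have "\<dots> < \<epsilon>" using \<open>\<epsilon> > 0\<close> by (simp add: e_def field_simps add_pos_nonneg)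
  finally have "Ck_norm k {0..1} (\<lambda>x. u' x - f x) < \<epsilon>" .
  moreover have "u' \<in> Ck_on k {0..1}"
    by (rule deriv_seq_imp_Ck_on[OF G]) (simp add: G_def)
  moreover have "u' \<in> C1s (a - 2) s"
    unfolding u'_def by (rule C1s_translation[OF u_in_C1s])
  \<comment> \<open>The untranslated equation holds on \<open>(0, \<infinity>)\<close>; as
    \<open>x + 2 > 0\<close>, the translated one includes \<open>x = 0\<close>.\<close>
  moreover have "caputo_deriv (a - 2) s u' x = 0" if "x \<ge> 0" for x
    unfolding u'_def using caputo_deriv_translation[OF u_in_C1s, where c = 2 and x = x] caputo_deriv_u[of "x + 2"] that a_less by simp
  moreover have "u' t = u' (a - 2)" if "t < a - 2" for t
    using u_initial[of "t + 2" c] that by (simp add: u'_def)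
  ultimately show ?thesis
    using a_less by (intro exI[of _ "a - 2"] conjI exI[of _ u']) auto
qed

end
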